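(* For integers $n,l\ge 1$ let $X_n^{(l)}$ denote the number of blocks of size $l$ in a uniformly random non-crossing partition of $[n]=\{1,\dots,n\}$, and define $$Z_n^{(l)}=\frac{X_n^{(l)}-\mathbb{E}(X_n^{(l)})}{\sqrt{\mathrm{Var}(X_n^{(l)})}}.$$ Then, for every $l\ge 1$, as $n\to\infty$, the cumulative distribution function of $Z_n^{(l)}$ converges to the standard Gaussian distribution function $\Phi(x)$.
   Context: A partition of $[n]=\{1,\dots,n\}$ into (nonempty) subsets, called blocks, is non-crossing if there are no elements $a<b<c<d$ such that $a$ and $c$ lie in one block and $b$ and $d$ lie in a different block. A random non-crossing partition of $[n]$ is one chosen uniformly from the finite set of all non-crossing partitions of $[n]$. The size (or length) of a block is its number of elements. *)

theory Defs
  imports "HOL-Probability.Probability"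
begin

definition non_crossing :: "nat set set \<Rightarrow> bool" where
  "non_crossing P \<longleftrightarrow>
    \<not> (\<exists>A\<in>P. \<exists>B\<in>P. A \<noteq> B \<and>
        (\<exists>a b c d. a < b \<and> b < c \<and> c < d \<and> a \<in> A \<and> c \<in> A \<and> b \<in> B \<and> d \<in> B))"

definition NC :: "nat \<Rightarrow> nat set set set" where
  "NC n = {P. partition_on {1..n} P \<and> non_crossing P}"

lemma finite_NC: "finite (NC n)"
  by (rule finite_subset[OF _ finitely_many_partition_on[of "{1..n}"]]) (auto simp: NC_def)

lemma NC_nonempty: "NC n \<noteq> {}"
proof -
  have "(\<lambda>i. {i}) ` {1..n} \<in> NC n"
    by (auto simp: NC_def non_crossing_def partition_on_def disjoint_def)
  then show ?thesis by blast
qed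

text \<open>By the two lemmas above, this is the genuine uniform distribution for every \<open>n\<close>.\<close>
definition random_NC :: "nat \<Rightarrow> nat set set pmf" where
  "random_NC n = pmf_of_set (NC n)"

definition num_blocks :: "nat \<Rightarrow> nat set set \<Rightarrow> real" where
  "num_blocks l P = real (card {A \<in> P. card A = l})"

text \<open>
  For those \<open>n\<close> for which the variance vanishes (e.g. \<open>n < l\<close>), the convention
  \<open>x / 0 = 0\<close> makes this identically \<open>0\<close>. Convergence to the normal distribution
  is not affected by finitely many such \<open>n\<close>, and fails if there are infinitely many.
\<close>
definition standardized_num_blocks :: "nat \<Rightarrow> nat \<Rightarrow> nat set set \<Rightarrow> real" where
  "standardized_num_blocks l n P =
    (num_blocks l P - measure_pmf.expectation (random_NC n) (num_blocks l)) /
      sqrt (measure_pmf.variance (random_NC n) (num_blocks l))"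

end

theory Submission
  imports Defs
begin

text \<open>Write \<open>N = n + 1\<close>. A non-crossing partition of \<open>{1..n}\<close> is determined by the word that records
  the size of every block at its smallest element and \<open>0\<close> elsewhere, and the words that arise are
  the ballot words (\<open>ballot_encodes_unique\<close>). By the cycle lemma (\<open>cycle_lemma\<close>), every weak
  composition of \<open>n\<close> into \<open>N\<close> parts has exactly one rotation that is a ballot word followed by a
  \<open>0\<close>. Rotating does not change how often a letter occurs, so the number of blocks of size \<open>l\<close> has
  the law of the number of parts equal to \<open>l\<close> in a uniformly random weak composition of \<open>n\<close> into
  \<open>N\<close> parts (\<open>expectation_random_NC\<close>).

  Such a composition consists of \<open>N\<close> independent geometric variables, with weights
  \<open>geom k = 2 ^ -(k + 1)\<close> and mean \<open>1\<close>, conditioned on their sum being \<open>n\<close>. The conditioning is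
  resolved by Fourier inversion: all expectations become ratios of integrals over \<open>[-pi, pi]\<close> of
  products of \<open>N\<close> one-letter transforms (\<open>sum_weak_compositions_Fourier\<close>). After the substitution
  \<open>\<theta> = u / sqrt N\<close>, the integrands converge pointwise by a Taylor expansion and are dominated by
  Gaussians times polynomials, because all but at most two of the factors are transforms bounded by
  \<open>exp (- c * \<theta>\<^sup>2)\<close> in modulus (\<open>char_fun_decay\<close>).

  Let \<open>p = geom l\<close> and let \<open>W\<close> be the number of blocks of size \<open>l\<close> minus \<open>N * p\<close>, divided by
  \<open>sqrt N\<close>. The integral for the characteristic function of \<open>W\<close> converges, up to the
  factor \<open>sqrt pi\<close> that cancels in the ratio, to a Gaussian characteristic function with variance \<open>p * (1 - p) - (p * (l - 1))\<^sup>2 / 2\<close>: the variance of the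
  indicator of the letter \<open>l\<close>, reduced by what its correlation with the sum explains. The same
  method gives the limits of \<open>E W\<close> and \<open>E W\<^sup>2\<close>, so that centring and scaling by the true mean and
  variance is asymptotically the same as centring and scaling by the limits. For this to combine,
  the characteristic function is treated at arguments that vary with \<open>n\<close>
  (\<open>block_dev_char_limit\<close>); Levy's continuity theorem concludes.\<close>

section \<open>Non-crossing partitions and ballot words\<close>

definition initial_segment :: "nat set \<Rightarrow> nat set \<Rightarrow> bool" where
  "initial_segment S T \<longleftrightarrow> S \<subseteq> T \<and> (\<forall>x\<in>S. \<forall>y\<in>T. y < x \<longrightarrow> y \<in> S)"

lemma initial_segment_exists:
  assumes "finite T" "s \<le> card T"
  shows "\<exists>S. initial_segment S T \<and> card S = s"
  using assms(2)
proof (induction s)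
  case 0
  then show ?case by (intro exI[of _ "{}"]) (auto simp: initial_segment_def)
next
  case (Suc s)
  then obtain S where S: "initial_segment S T" "card S = s" by auto
  have fS: "finite S" using S assms(1) by (auto simp: initial_segment_def intro: finite_subset)
  have ne: "T - S \<noteq> {}"
    using S Suc.prems by (auto simp: initial_segment_def)
  have fin: "finite (T - S)" using assms(1) by simp
  define m where "m = Min (T - S)"
  have m: "m \<in> T - S" "\<And>y. y \<in> T - S \<Longrightarrow> m \<le> y"
    unfolding m_def using Min_in[OF fin ne] Min_le[OF fin] by auto
  have "initial_segment (insert m S) T"
    using S m unfolding initial_segment_def by (auto simp: not_le[symmetric])
  moreover have "card (insert m S) = Suc s" using m S fS by simp
  ultimately show ?case by blast
qed

text \<open>Two initial segments of the same set are comparable by inclusion.\<close>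
lemma initial_segment_unique:
  assumes "finite T" "initial_segment S T" "initial_segment S' T" "card S = card S'"
  shows "S = S'"
proof -
  have fin: "finite S" "finite S'"
    using assms by (auto simp: initial_segment_def intro: finite_subset)
  have "S \<subseteq> S' \<or> S' \<subseteq> S"
  proof (rule ccontr)
    assume "\<not> ?thesis"
    then obtain x y where "x \<in> S" "x \<notin> S'" "y \<in> S'" "y \<notin> S" by auto
    then show False using assms(2,3) unfolding initial_segment_def
      by (metis linorder_neqE_nat subsetD)
  qed
  then show ?thesis using card_subset_eq fin assms(4) by metis
qed

lemma non_crossingD:
  assumes "non_crossing P" "A \<in> P" "B \<in> P" "a < b" "b < c" "c < d"
    "a \<in> A" "c \<in> A" "b \<in> B" "d \<in> B"
  shows "A = B"
  using assms unfolding non_crossing_def by metis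

lemma non_crossing_subset:
  assumes "non_crossing P" "Q \<subseteq> P"
  shows "non_crossing Q"
  using assms unfolding non_crossing_def by (meson subsetD)

definition ballot :: "nat set \<Rightarrow> (nat \<Rightarrow> nat) \<Rightarrow> bool" where
  "ballot V c \<longleftrightarrow> sum c V = card V \<and>
     (\<forall>v\<in>V. card {u\<in>V. u \<le> v} \<le> sum c {u\<in>V. u \<le> v})"

text \<open>The word \<open>c\<close> carries the size of each block of \<open>P\<close> at the smallest element of the block, and \<open>0\<close>
  at all other elements of \<open>V\<close>. Arbitrary finite ground sets \<open>V\<close> are allowed so that blocks can be
  removed without renumbering.\<close>
definition encodes :: "nat set \<Rightarrow> (nat \<Rightarrow> nat) \<Rightarrow> nat set set \<Rightarrow> bool" where
  "encodes V c P \<longleftrightarrow> partition_on V P \<and> non_crossing P \<and>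
     (\<forall>B\<in>P. c (Min B) = card B) \<and> (\<forall>v\<in>V. v \<notin> Min ` P \<longrightarrow> c v = 0)"

lemma partition_on_block:
  assumes "partition_on V P" "finite V" "B \<in> P"
  shows "finite B" "B \<noteq> {}" "B \<subseteq> V" "Min B \<in> B" "Min B \<in> V" "card B > 0"
proof -
  show *: "B \<subseteq> V" "B \<noteq> {}" using assms by (auto simp: partition_on_def)
  then show "finite B" using assms by (auto intro: finite_subset)
  then show "Min B \<in> B" "card B > 0" using * by (auto simp: card_gt_0_iff)
  then show "Min B \<in> V" using * by auto
qed

lemma partition_on_same_block:
  assumes "partition_on V P" "A \<in> P" "B \<in> P" "x \<in> A" "x \<in> B"
  shows "A = B"
  using assms by (auto simp: partition_on_def disjoint_def)

lemma inj_on_Min_blocks: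
  assumes "partition_on V P" "finite V"
  shows "inj_on Min P"
  by (intro inj_onI) (metis assms partition_on_same_block partition_on_block(4))

text \<open>The nonzero letters of the word are in bijection with the blocks, so block statistics are letter
  statistics. The restriction to blocks that start in \<open>U\<close> is what yields the prefix sums below.\<close>
lemma encodes_sum:
  fixes g :: "nat \<Rightarrow> 'a::comm_monoid_add"
  assumes "finite V" "encodes V c P" "U \<subseteq> V" "g 0 = 0"
  shows "(\<Sum>v\<in>U. g (c v)) = (\<Sum>B | B \<in> P \<and> Min B \<in> U. g (card B))"
proof -
  have P: "partition_on V P" using assms(2) by (simp add: encodes_def)
  have "(\<Sum>v\<in>U. g (c v)) = (\<Sum>v\<in>Min ` {B\<in>P. Min B \<in> U}. g (c v))"
  proof (rule sum.mono_neutral_right)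
    show "finite U" using assms(1,3) by (rule finite_subset[rotated])
    show "\<forall>i\<in>U - Min ` {B \<in> P. Min B \<in> U}. g (c i) = 0"
      using assms(2,3,4) unfolding encodes_def by (auto simp: image_iff)
  qed auto
  also have "\<dots> = (\<Sum>B | B \<in> P \<and> Min B \<in> U. g (c (Min B)))"
    by (subst sum.reindex)
      (use inj_on_Min_blocks[OF P assms(1)] in \<open>auto intro: inj_on_subset\<close>)
  also have "\<dots> = (\<Sum>B | B \<in> P \<and> Min B \<in> U. g (card B))"
    by (rule sum.cong) (use assms(2) in \<open>auto simp: encodes_def\<close>)
  finally show ?thesis .
qed

text \<open>The blocks that start up to \<open>v\<close> cover everything up to \<open>v\<close>, so their sizes add up to at least the
  number of elements up to \<open>v\<close>.\<close>
lemma encodes_imp_ballot: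
  assumes "finite V" "encodes V c P"
  shows "ballot V c"
proof -
  have P: "partition_on V P" using assms(2) by (simp add: encodes_def)
  note bl = partition_on_block[OF P assms(1)]
  have finP: "finite P" using P assms(1) by (metis finite_elements)
  have sum_eq: "sum c U = sum card {B\<in>P. Min B \<in> U}" if "U \<subseteq> V" for U
    using encodes_sum[OF assms that, of "\<lambda>x. x"] by simp
  have "sum c V = sum card {B\<in>P. Min B \<in> V}" by (rule sum_eq) auto
  also have "{B\<in>P. Min B \<in> V} = P" using bl by auto
  also have "sum card P = card V"
    using P bl(1) by (subst card_Union_disjoint[symmetric]) (auto simp: partition_on_def)
  finally have 1: "sum c V = card V" .
  have 2: "card {u\<in>V. u \<le> v} \<le> sum c {u\<in>V. u \<le> v}" for v
  proof -
    let ?Q = "{B\<in>P. Min B \<in> {u\<in>V. u \<le> v}}"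
    have "{u\<in>V. u \<le> v} \<subseteq> \<Union> ?Q"
    proof
      fix u assume u: "u \<in> {u\<in>V. u \<le> v}"
      then obtain B where B: "B \<in> P" "u \<in> B" using P by (auto simp: partition_on_def)
      then have "Min B \<le> u" using bl(1) by simp
      then show "u \<in> \<Union> ?Q" using B u bl(5) by auto
    qed
    then have "card {u\<in>V. u \<le> v} \<le> card (\<Union> ?Q)"
      using finP bl(1) by (intro card_mono) auto
    also have "\<dots> \<le> sum card ?Q"
      using card_Union_le_sum_card by blast
    also have "\<dots> = sum c {u\<in>V. u \<le> v}" by (rule sum_eq[symmetric]) auto
    finally show ?thesis .
  qed
  show ?thesis using 1 2 by (simp add: ballot_def)
qed

text \<open>The block that starts last is an interval of \<open>V\<close>: an element of \<open>V\<close> between two of its elements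
  that lies in another block belongs to a block that starts earlier, and the two blocks cross.\<close>
lemma last_block_initial_segment:
  assumes fin: "finite V" and enc: "encodes V c P" and B: "B \<in> P"
    and last: "\<And>v. v \<in> V \<Longrightarrow> c v > 0 \<Longrightarrow> v \<le> Min B"
  shows "initial_segment B {v\<in>V. Min B \<le> v}"
proof -
  have P: "partition_on V P" using enc by (simp add: encodes_def)
  note bl = partition_on_block[OF P fin]
  have "y \<in> B" if xy: "x \<in> B" "y \<in> V" "Min B \<le> y" "y < x" for x y
  proof (rule ccontr)
    assume y: "y \<notin> B"
    obtain A where A: "A \<in> P" "y \<in> A" using P xy(2) by (auto simp: partition_on_def)
    have AB: "A \<noteq> B" using A y by auto
    have "c (Min A) > 0" using enc A bl(6) by (auto simp: encodes_def)
    then have "Min A \<le> Min B" using last bl(5) A by auto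
    moreover have "Min A \<noteq> Min B" using AB A B inj_on_Min_blocks[OF P fin] by (auto dest: inj_onD)
    ultimately have "Min A < Min B" by simp
    moreover have "Min B < y" using xy(3) y bl(4)[OF B] by (cases "Min B = y") auto
    ultimately have "A = B"
      using non_crossingD[of P A B "Min A" "Min B" y x] A B bl(4)[OF A(1)] bl(4)[OF B] xy(1,4) enc
      by (simp add: encodes_def)
    then show False using AB by simp
  qed
  then show ?thesis unfolding initial_segment_def using bl(1)[OF B] bl(3)[OF B] by auto
qed

lemma encodes_remove_block:
  assumes fin: "finite V" and enc: "encodes V c P" and B: "B \<in> P"
  and zero: "\<And>v. v \<in> B \<Longrightarrow> v \<noteq> Min B \<Longrightarrow> c v = 0"
  shows "encodes (V - B) c (P - {B})"
proof -
  have P: "partition_on V P" using enc by (simp add: encodes_def)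
  note bl = partition_on_block[OF P fin]
  have "partition_on (V - B) (P - {B})"
    using P B partition_on_same_block[OF P]
    by (subst (asm) insert_Diff[OF B, symmetric], subst (asm) partition_on_insert)
      (auto simp: disjnt_iff)
  moreover have "c v = 0" if "v \<in> V - B" "v \<notin> Min ` (P - {B})" for v
  proof -
    have "v \<noteq> Min B" using that(1) bl(4)[OF B] by auto
    then have "v \<notin> Min ` P" using that(2) by auto
    then show ?thesis using enc that(1) by (simp add: encodes_def)
  qed
  moreover have "non_crossing (P - {B})"
    by (rule non_crossing_subset[of P]) (use enc in \<open>auto simp: encodes_def\<close>)
  ultimately show ?thesis using enc by (simp add: encodes_def)
qed

text \<open>A block that is convex in \<open>V\<close> crosses no other block, so it can be put back.\<close>
lemma encodes_insert_block:
  assumes fin: "finite V" and BV: "B \<subseteq> V" "B \<noteq> {}"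
    and convex: "\<And>x y z. x \<in> B \<Longrightarrow> z \<in> B \<Longrightarrow> y \<in> V \<Longrightarrow> x < y \<Longrightarrow> y < z \<Longrightarrow> y \<in> B"
    and c: "c (Min B) = card B" "\<And>v. v \<in> B \<Longrightarrow> v \<noteq> Min B \<Longrightarrow> c v = 0"
    and enc: "encodes (V - B) c P"
  shows "encodes V c (insert B P)"
proof -
  have P: "partition_on (V - B) P" using enc by (simp add: encodes_def)
  have sub: "A \<subseteq> V - B" if "A \<in> P" for A using P that by (auto simp: partition_on_def)
  have "partition_on V (insert B P)"
    using P BV sub by (subst partition_on_insert) (auto simp: disjnt_def)
  moreover have "non_crossing (insert B P)"
  proof -
    have "\<not> (a < b \<and> b < c' \<and> c' < d \<and> a \<in> A \<and> c' \<in> A \<and> b \<in> A' \<and> d \<in> A')"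
      if A: "A \<in> insert B P" "A' \<in> insert B P" "A \<noteq> A'" for A A' a b c' d
    proof
      assume x: "a < b \<and> b < c' \<and> c' < d \<and> a \<in> A \<and> c' \<in> A \<and> b \<in> A' \<and> d \<in> A'"
      consider "A = B" "A' \<in> P" | "A' = B" "A \<in> P" | "A \<in> P" "A' \<in> P" using A by auto
      then show False
      proof cases
        case 1
        then show ?thesis using x sub[of A'] convex[of a c' b] by auto
      next
        case 2
        then show ?thesis using x sub[of A] convex[of b d c'] by auto
      next
        case 3
        then show ?thesis using x A enc unfolding encodes_def non_crossing_def by metis
      qed
    qed
    then show ?thesis unfolding non_crossing_def by metis
  qed
  moreover have "c v = 0" if "v \<in> V" "v \<notin> Min ` insert B P" for v
  proof (cases "v \<in> B")
    case True
    then show ?thesis using that(2) c(2) by auto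
  next
    case False
    then show ?thesis using that enc by (simp add: encodes_def)
  qed
  ultimately show ?thesis using enc c(1) by (simp add: encodes_def)
qed

text \<open>Induction on the size of \<open>V\<close>. The last nonzero letter of the word has to be the size of the block
  that starts last, and this block is an interval, so it consists of the corresponding number of
  consecutive elements of \<open>V\<close>. The ballot condition says that there is room for it. After its
  removal the rest of the word is again a ballot word.\<close>
theorem ballot_encodes_unique:
  assumes "finite V" "ballot V c"
  shows "\<exists>!P. encodes V c P"
  using assms
proof (induction "card V" arbitrary: V rule: less_induct)
  case less
  note fin = less.prems(1)
  show ?case
  proof (cases "V = {}")
    case True
    then show ?thesis
      by (intro ex1I[of _ "{}"]) (auto simp: encodes_def partition_on_def non_crossing_def)
  next
    case False
    have tot: "sum c V = card V" and pre: "\<And>v. v \<in> V \<Longrightarrow> card {u\<in>V. u \<le> v} \<le> sum c {u\<in>V. u \<le> v}"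
      using less.prems(2) by (auto simp: ballot_def)
    \<comment> \<open>\<open>m\<close> is the position of the last nonzero letter, the smallest element of the last block\<close>
    define U where "U = {v\<in>V. c v > 0}"
    have "U \<noteq> {}"
    proof
      assume "U = {}"
      then have "sum c V = 0" by (auto simp: U_def)
      then show False using tot False fin by simp
    qed
    define m where "m = Max U"
    have finU: "finite U" using fin by (simp add: U_def)
    have m: "m \<in> V" "c m > 0" "\<And>v. v \<in> V \<Longrightarrow> c v > 0 \<Longrightarrow> v \<le> m"
      using Max_in[OF finU \<open>U \<noteq> {}\<close>] Max_ge[OF finU] by (auto simp: m_def U_def)
    define T where "T = {v\<in>V. m \<le> v}"
    define L where "L = {v\<in>V. v < m}"
    have TL: "V = L \<union> T" "L \<inter> T = {}" "finite L" "finite T" "m \<in> T" using fin m by (auto simp: L_def T_def)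
    have "sum c T = sum c {m}"
    proof (rule sum.mono_neutral_right)
      show "\<forall>v\<in>T - {m}. c v = 0"
      proof
        fix v assume v: "v \<in> T - {m}"
        then have "v \<in> V" "m < v" by (auto simp: T_def)
        then show "c v = 0" using m(3)[of v] by auto
      qed
    qed (use TL in auto)
    then have cL: "sum c L + c m = card V"
      using tot TL sum.union_disjoint[of L T c] by simp
    have "card L \<le> sum c L"
    proof (cases "L = {}")
      case False
      have "Max L \<in> L" using False TL by simp
      moreover have "{u\<in>V. u \<le> Max L} = L"
      proof -
        have "Max L \<in> V" "Max L < m" using \<open>Max L \<in> L\<close> by (simp_all add: L_def)
        moreover have "u \<le> Max L" if "u \<in> V" "u < m" for u
          by (rule Max_ge[OF TL(3)]) (use that in \<open>simp add: L_def\<close>)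
        ultimately show ?thesis unfolding L_def by (intro Collect_cong) (metis le_less_trans)
      qed
      ultimately show ?thesis using pre[of "Max L"] by (auto simp: L_def)
    qed auto
    then have "c m \<le> card T" using cL TL card_Un_disjoint[of L T] by simp
    then obtain B where B: "initial_segment B T" "card B = c m"
      using initial_segment_exists TL by blast
    have BT: "B \<subseteq> T" "finite B" "B \<noteq> {}"
      using B m(2) TL by (auto simp: initial_segment_def intro: finite_subset)
    have "m \<in> B"
    proof -
      obtain x where x: "x \<in> B" using BT by auto
      then have "m \<le> x" using BT by (auto simp: T_def)
      then show ?thesis using x B(1) TL(5) unfolding initial_segment_def by (cases "x = m") auto
    qed
    then have MinB: "Min B = m" using BT by (intro Min_eqI) (auto simp: T_def)
    have BV: "B \<subseteq> V" using BT by (auto simp: T_def)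
    have conv: "y \<in> B" if "x \<in> B" "z \<in> B" "y \<in> V" "x < y" "y < z" for x y z
      using that B BT unfolding initial_segment_def T_def by auto
    have zero: "c v = 0" if "v \<in> B" "v \<noteq> m" for v
      using that BT m(3)[of v] by (auto simp: T_def)
    have small: "card (V - B) < card V"
      using BV BT fin by (intro psubset_card_mono) auto
    have cardVB: "card (V - B) = card V - c m" using BV BT B fin by (simp add: card_Diff_subset)
    have sumB: "sum c B = c m"
    proof -
      have "sum c B = sum c {m}"
        by (rule sum.mono_neutral_right) (use BT \<open>m \<in> B\<close> zero in auto)
      then show ?thesis by simp
    qed
    have sumVB: "sum c (V - B) = sum c L" using sum_diff_nat[of B V c] BV BT sumB tot cL by simp
    have "ballot (V - B) c"
      unfolding ballot_def
    proof (intro conjI ballI)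
      show "sum c (V - B) = card (V - B)" using sumVB cardVB cL by simp
      fix v assume v: "v \<in> V - B"
      show "card {u \<in> V - B. u \<le> v} \<le> sum c {u \<in> V - B. u \<le> v}"
      proof (cases "v < m")
        case True
        then have "{u \<in> V - B. u \<le> v} = {u \<in> V. u \<le> v}" using BT by (auto simp: T_def)
        then show ?thesis using pre v by auto
      next
        case False
        have "L \<subseteq> {u \<in> V - B. u \<le> v}" using False BT by (auto simp: L_def T_def)
        then have "sum c L \<le> sum c {u \<in> V - B. u \<le> v}" using fin by (intro sum_mono2) auto
        moreover have "card {u \<in> V - B. u \<le> v} \<le> card (V - B)" using fin by (intro card_mono) auto
        ultimately show ?thesis using cardVB cL by simp
      qed
    qed
    then have ex1: "\<exists>!P. encodes (V - B) c P" using less.hyps[OF small] fin by auto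
    then obtain P where P: "encodes (V - B) c P" by blast
    have "encodes V c (insert B P)"
      using encodes_insert_block[OF fin BV BT(3) conv _ _ P] B zero MinB by auto
    moreover have "Q = insert B P" if Q: "encodes V c Q" for Q
    proof -
      have pQ: "partition_on V Q" using Q by (simp add: encodes_def)
      obtain B' where B': "B' \<in> Q" "Min B' = m" using Q m unfolding encodes_def by fastforce
      have "initial_segment B' T"
        unfolding T_def B'(2)[symmetric] by (rule last_block_initial_segment[OF fin Q B'(1)]) (use m B' in auto)
      moreover have "card B' = card B" using Q B' B by (auto simp: encodes_def)
      ultimately have "B' = B" using initial_segment_unique TL B by blast
      then have "encodes (V - B) c (Q - {B})" using encodes_remove_block[OF fin Q B'(1)] zero B' by auto
      then have "Q - {B} = P" using ex1 P by blast
      then show ?thesis using B' \<open>B' = B\<close> by auto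
    qed
    ultimately show ?thesis by blast
  qed
qed

section \<open>The cycle lemma and the law of the block counts\<close>

text \<open>Compositions are extensional functions, so that each is counted once.\<close>
definition weak_compositions :: "nat \<Rightarrow> nat \<Rightarrow> (nat \<Rightarrow> nat) set" where
  "weak_compositions N n = {c \<in> {..<N} \<rightarrow>\<^sub>E UNIV. sum c {..<N} = n}"

definition rotation :: "nat \<Rightarrow> nat \<Rightarrow> (nat \<Rightarrow> nat) \<Rightarrow> nat \<Rightarrow> nat" where
  "rotation N r c = (\<lambda>i\<in>{..<N}. c ((i + r) mod N))"

lemma weak_compositions_subset:
  "weak_compositions N n \<subseteq> {..<N} \<rightarrow>\<^sub>E {..n}"
proof
  fix c assume c: "c \<in> weak_compositions N n"
  have "c i \<le> n" if "i < N" for i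
    using member_le_sum[of i "{..<N}" c] that c by (simp add: weak_compositions_def)
  then show "c \<in> {..<N} \<rightarrow>\<^sub>E {..n}" using c by (auto simp: weak_compositions_def PiE_iff)
qed

lemma finite_weak_compositions: "finite (weak_compositions N n)"
  by (rule finite_subset[OF weak_compositions_subset]) (auto intro: finite_PiE)

lemma sum_lessThan_add:
  fixes f :: "nat \<Rightarrow> 'a::comm_monoid_add"
  shows "sum f {..<a + b} = sum f {..<a} + (\<Sum>j<b. f (j + a))"
  by (induction b) (auto simp: add.assoc add.commute[of a])

lemma add_mod_inverse:
  assumes "r + s = N" "i < (N::nat)"
  shows "((i + r) mod N + s) mod N = i"
proof -
  have "((i + r) mod N + s) mod N = (i + r + s) mod N" by (rule mod_add_left_eq)
  also have "i + r + s = i + N" using assms(1) by simp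
  finally show ?thesis using assms(2) by simp
qed

lemma bij_betw_add_mod:
  assumes "r \<le> N"
  shows "bij_betw (\<lambda>i. (i + r) mod N) {..<N} {..<N::nat}"
proof (rule bij_betw_byWitness[where f' = "\<lambda>i. (i + (N - r)) mod N"])
  show "\<forall>i\<in>{..<N}. ((i + r) mod N + (N - r)) mod N = i"
    using add_mod_inverse[of r "N - r" N] assms by simp
  show "\<forall>i\<in>{..<N}. ((i + (N - r)) mod N + r) mod N = i"
    using add_mod_inverse[of "N - r" r N] assms by simp
qed auto

lemma sum_rotation:
  assumes "r \<le> N"
  shows "(\<Sum>i<N. g (rotation N r c i)) = (\<Sum>i<N. g (c i))"
  using sum.reindex_bij_betw[OF bij_betw_add_mod[OF assms], of "\<lambda>i. g (c i)"]
  by (simp add: rotation_def)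

lemma rotation_weak_compositions:
  assumes "r \<le> N" "c \<in> weak_compositions N n"
  shows "rotation N r c \<in> weak_compositions N n"
  using sum_rotation[OF assms(1), of "\<lambda>x. x" c] assms(2)
  by (auto simp: weak_compositions_def rotation_def)

lemma rotation_inverse:
  assumes "r \<le> N" "c \<in> weak_compositions N n"
  shows "rotation N (N - r) (rotation N r c) = c"
proof
  fix i
  show "rotation N (N - r) (rotation N r c) i = c i"
  proof (cases "i < N")
    case True
    then have "((i + (N - r)) mod N + r) mod N = i" using assms(1) by (intro add_mod_inverse) auto
    then show ?thesis using True by (simp add: rotation_def)
  next
    case False
    then show ?thesis using assms(2)
      by (auto simp: rotation_def weak_compositions_def PiE_iff extensional_def)
  qed
qed

lemma bij_betw_rotation:
  assumes "r \<le> N"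
  shows "bij_betw (rotation N r) (weak_compositions N n) (weak_compositions N n)"
proof (rule bij_betw_byWitness[where f' = "rotation N (N - r)"])
  show "\<forall>c\<in>weak_compositions N n. rotation N (N - r) (rotation N r c) = c"
    using rotation_inverse[OF assms] by blast
  show "\<forall>c\<in>weak_compositions N n. rotation N r (rotation N (N - r) c) = c"
    using rotation_inverse[of "N - r" N] assms by fastforce
qed (use rotation_weak_compositions assms in auto)

text \<open>The ballot condition in terms of the positions \<open>0, 1, ...\<close> of a word.\<close>
definition dominating :: "nat \<Rightarrow> (nat \<Rightarrow> nat) \<Rightarrow> bool" where
  "dominating n c \<longleftrightarrow> (\<forall>i\<le>n. i \<le> sum c {..<i})"

text \<open>Consider the walk \<open>D\<close> with steps \<open>c j - 1\<close>, continued periodically. It loses exactly \<open>1\<close> per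
  period, and the rotation by \<open>r\<close> is dominating if and only if the walk stays at or above \<open>D r\<close>
  for the period that starts at \<open>r\<close>. This holds precisely for the first minimum in a period.\<close>
lemma cycle_lemma:
  assumes c: "c \<in> weak_compositions (Suc n) n"
  shows "\<exists>!r. r < Suc n \<and> dominating n (rotation (Suc n) r c)"
proof -
  define N where "N = Suc n"
  \<comment> \<open>the walk with steps \<open>c j - 1\<close>, continued periodically\<close>
  define D where "D i = int (\<Sum>j<i. c (j mod N)) - int i" for i
  have period: "D (i + N) = D i - 1" for i
  proof -
    have "(\<Sum>j<N + i. c (j mod N)) = (\<Sum>j<N. c (j mod N)) + (\<Sum>j<i. c ((j + N) mod N))"
      by (rule sum_lessThan_add)
    also have "(\<Sum>j<N. c (j mod N)) = n" using c by (simp add: weak_compositions_def N_def)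
    finally have "(\<Sum>j<i + N. c (j mod N)) = n + (\<Sum>j<i. c (j mod N))" by (simp add: add.commute)
    then show ?thesis by (simp add: D_def N_def del: sum.lessThan_Suc)
  qed
  have dom: "dominating n (rotation N r c) \<longleftrightarrow> (\<forall>i<N. D r \<le> D (r + i))" for r
  proof -
    have "i \<le> sum (rotation N r c) {..<i} \<longleftrightarrow> D r \<le> D (r + i)" if "i < N" for i
    proof -
      have "sum (rotation N r c) {..<i} = (\<Sum>j<i. c ((j + r) mod N))"
        using that by (auto simp: rotation_def)
      moreover have "(\<Sum>j<r + i. c (j mod N)) = (\<Sum>j<r. c (j mod N)) + (\<Sum>j<i. c ((j + r) mod N))"
        by (rule sum_lessThan_add)
      ultimately show ?thesis by (simp add: D_def flip: of_nat_sum)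
    qed
    then show ?thesis unfolding dominating_def N_def less_Suc_eq_le by blast
  qed
  have uniq: "\<not> (\<forall>i<N. D r \<le> D (r + i)) \<or> \<not> (\<forall>i<N. D s \<le> D (s + i))"
    if rs: "r < s" "s < N" for r s
  proof (rule ccontr)
    assume a: "\<not> ?thesis"
    moreover have "s - r < N" "r + N - s < N" using rs by auto
    \<comment> \<open>from \<open>r\<close> to \<open>s\<close>, and from \<open>s\<close> to the next period of \<open>r\<close>, where the walk is lower by \<open>1\<close>\<close>
    ultimately have "D r \<le> D (r + (s - r))" "D s \<le> D (s + (r + N - s))" by blast+
    moreover have "r + (s - r) = s" "s + (r + N - s) = r + N" using rs by auto
    ultimately have "D r \<le> D s" "D s \<le> D (r + N)" by simp_all
    then show False by (simp add: period)
  qed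
  \<comment> \<open>the first position in the period at which the walk is minimal\<close>
  define r where "r = (LEAST i. i < N \<and> D i = Min (D ` {..<N}))"
  have "Min (D ` {..<N}) \<in> D ` {..<N}" by (rule Min_in) (auto simp: N_def)
  then have "\<exists>i. i < N \<and> D i = Min (D ` {..<N})" by fastforce
  then have r: "r < N" "D r = Min (D ` {..<N})" unfolding r_def by (metis (mono_tags, lifting) LeastI_ex)+
  have min: "D r \<le> D i" if "i < N" for i using that r by simp
  have first: "D r < D i" if "i < r" for i
  proof -
    have "D i \<noteq> D r" using not_less_Least[of i "\<lambda>i. i < N \<and> D i = Min (D ` {..<N})"] that r
      by (auto simp: r_def[symmetric])
    moreover have "D r \<le> D i" using min[of i] that r(1) by simp
    ultimately show ?thesis by simp
  qed
  have "D r \<le> D (r + i)" if "i < N" for i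
  proof (cases "r + i < N")
    case False
    then have "D (r + i) = D (r + i - N) - 1" using period[of "r + i - N"] by simp
    moreover have "r + i - N < r" using that False by simp
    ultimately show ?thesis using first[of "r + i - N"] by simp
  qed (use min in auto)
  then have "dominating n (rotation N r c)" by (simp add: dom)
  moreover have "s = r" if "s < N" "dominating n (rotation N s c)" for s
    using uniq[of r s] uniq[of s r] that \<open>\<And>i. i < N \<Longrightarrow> D r \<le> D (r + i)\<close> r(1)
    unfolding dom by (cases s r rule: linorder_cases) auto
  ultimately show ?thesis using r(1) unfolding N_def by blast
qed

text \<open>Double counting of pairs of a composition and its dominating rotation. A statistic that is a
  function of a sum over all letters is invariant under rotation.\<close>
lemma sum_weak_compositions_cycle:
  fixes h :: "'b::comm_monoid_add \<Rightarrow> 'a::comm_semiring_1"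
  shows "(\<Sum>c\<in>weak_compositions (Suc n) n. h (\<Sum>i<Suc n. g (c i))) =
    of_nat (Suc n) * (\<Sum>c | c \<in> weak_compositions (Suc n) n \<and> dominating n c. h (\<Sum>i<Suc n. g (c i)))"
proof -
  define N where "N = Suc n"
  define W where "W = weak_compositions N n"
  define F where "F c = h (\<Sum>i<N. g (c i))" for c
  have rot_bij: "bij_betw (rotation N r) W W" if "r < N" for r
    unfolding W_def using that by (intro bij_betw_rotation) simp
  have F_rot: "F (rotation N r c) = F c" if "r < N" for r c
    unfolding F_def using that by (simp only: sum_rotation[of r N] less_imp_le)
  have "sum F W = (\<Sum>c\<in>W. \<Sum>r<N. if dominating n (rotation N r c) then F c else 0)"
  proof (rule sum.cong)
    fix c assume "c \<in> W"
    then obtain r where r: "r < N" "dominating n (rotation N r c)"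
      "\<And>s. s < N \<Longrightarrow> dominating n (rotation N s c) \<Longrightarrow> s = r"
      using cycle_lemma[of c n] unfolding W_def N_def by metis
    then have iff: "dominating n (rotation N s c) = (s = r)" if "s < N" for s using that by metis
    have "(\<Sum>s<N. if dominating n (rotation N s c) then F c else 0) =
      (\<Sum>s<N. if s = r then F c else 0)"
      by (rule sum.cong) (simp_all only: iff lessThan_iff)
    then show "F c = (\<Sum>r<N. if dominating n (rotation N r c) then F c else 0)"
      using r(1) by simp
  qed simp
  also have "\<dots> = (\<Sum>r<N. \<Sum>c\<in>W. if dominating n (rotation N r c) then F c else 0)"
    by (rule sum.swap)
  also have "\<dots> = (\<Sum>r<N. \<Sum>c\<in>W. if dominating n c then F c else 0)"
  proof (rule sum.cong)
    fix r assume r: "r \<in> {..<N}"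
    have "(\<Sum>c\<in>W. if dominating n c then F c else 0) =
      (\<Sum>c\<in>W. if dominating n (rotation N r c) then F (rotation N r c) else 0)"
      by (rule sum.reindex_bij_betw[OF rot_bij, symmetric]) (use r in auto)
    then show "(\<Sum>c\<in>W. if dominating n (rotation N r c) then F c else 0) =
      (\<Sum>c\<in>W. if dominating n c then F c else 0)"
      using r by (simp only: F_rot lessThan_iff)
  qed simp
  also have "\<dots> = of_nat N * (\<Sum>c | c \<in> W \<and> dominating n c. F c)"
    using finite_weak_compositions[of N n] by (simp add: W_def sum.If_cases Int_def)
  finally show ?thesis unfolding F_def W_def N_def .
qed

text \<open>A dominating word of length \<open>n + 1\<close> and sum \<open>n\<close> is a ballot word on \<open>{1..n}\<close> followed by a \<open>0\<close>.\<close>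
lemma ballot_shift_iff_dominating:
  assumes c: "c \<in> weak_compositions (Suc n) n"
  shows "ballot {1..n} (\<lambda>v. c (v - 1)) \<longleftrightarrow> dominating n c"
proof -
  have shift: "(\<Sum>u\<in>{1..v}. c (u - 1)) = sum c {..<v}" for v
    using sum.shift_bounds_cl_Suc_ivl[of "\<lambda>u. c (u - 1)" 0 "v - 1"]
    by (cases v) (auto simp: lessThan_Suc_atMost atMost_atLeast0)
  have pre: "{u \<in> {1..n}. u \<le> v} = {1..v}" if "v \<in> {1..n}" for v using that by auto
  have tot: "sum c {..<n} + c n = n" using c by (simp add: weak_compositions_def)
  show ?thesis
  proof
    assume b: "ballot {1..n} (\<lambda>v. c (v - 1))"
    have "i \<le> sum c {..<i}" if "i \<le> n" for i
    proof (cases "i = 0")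
      case False
      then have i: "i \<in> {1..n}" using that by auto
      have "\<forall>v\<in>{1..n}. card {u\<in>{1..n}. u \<le> v} \<le> (\<Sum>u | u \<in> {1..n} \<and> u \<le> v. c (u - 1))"
        using b unfolding ballot_def by (rule conjunct2)
      from bspec[OF this i] have "card {1..i} \<le> (\<Sum>u\<in>{1..i}. c (u - 1))"
        unfolding pre[OF i] .
      then show ?thesis by (simp only: shift) simp
    qed simp
    then show "dominating n c" by (simp add: dominating_def)
  next
    assume d: "dominating n c"
    then have "sum c {..<n} = n" using tot by (auto simp: dominating_def dest!: spec[of _ n])
    moreover have "v \<le> sum c {..<v}" if "v \<in> {1..n}" for v
      using d that by (auto simp: dominating_def)
    ultimately show "ballot {1..n} (\<lambda>v. c (v - 1))"
      unfolding ballot_def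
    proof (intro conjI ballI)
      fix v assume v: "v \<in> {1..n}"
      show "card {u \<in> {1..n}. u \<le> v} \<le> (\<Sum>u | u \<in> {1..n} \<and> u \<le> v. c (u - 1))"
        unfolding pre[OF v] shift using \<open>\<And>v. v \<in> {1..n} \<Longrightarrow> v \<le> sum c {..<v}\<close>[OF v] by simp
    qed (simp only: shift card_atLeastAtMost diff_Suc_1 add.commute[of n 1] Suc_eq_plus1_left[symmetric])
  qed
qed

lemma encodes_word_exists:
  assumes "finite V" "partition_on V P" "non_crossing P"
  shows "\<exists>c. encodes V c P"
proof -
  define c where "c v = (if v \<in> Min ` P then card (inv_into P Min v) else 0)" for v
  have "c (Min B) = card B" if "B \<in> P" for B
    using that inj_on_Min_blocks[OF assms(2,1)] by (simp add: c_def inv_into_f_f)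
  then have "encodes V c P" using assms by (auto simp: encodes_def c_def)
  then show ?thesis by blast
qed

lemma encodes_determines_word:
  assumes "encodes V c P" "encodes V c' P" "v \<in> V"
  shows "c v = c' v"
  using assms unfolding encodes_def by (cases "v \<in> Min ` P") auto

lemma encodes_cong:
  assumes "finite V" "\<And>v. v \<in> V \<Longrightarrow> c v = c' v" "encodes V c P"
  shows "encodes V c' P"
proof -
  have "partition_on V P" using assms(3) by (simp add: encodes_def)
  then have "Min B \<in> V" if "B \<in> P" for B using partition_on_block(5) that assms(1) by blast
  then show ?thesis using assms(2,3) by (auto simp: encodes_def)
qed

text \<open>Decoding a dominating word is a bijection onto \<open>NC n\<close>. The hypothesis on \<open>g\<close> makes the letters
  \<open>0\<close>, which belong to no block, invisible.\<close>
lemma sum_NC_eq_sum_dominating: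
  fixes h :: "'b::comm_monoid_add \<Rightarrow> 'a::comm_monoid_add"
  assumes g: "g 0 = 0"
  shows "(\<Sum>P\<in>NC n. h (\<Sum>A\<in>P. g (card A))) =
    (\<Sum>c | c \<in> weak_compositions (Suc n) n \<and> dominating n c. h (\<Sum>i<Suc n. g (c i)))"
    (is "_ = sum _ ?G")
proof -
  define sh where "sh c = (\<lambda>v. c (v - 1))" for c :: "nat \<Rightarrow> nat"
  define dec where "dec c = (THE P. encodes {1..n} (sh c) P)" for c
  have G: "c n = 0" "ballot {1..n} (sh c)" "encodes {1..n} (sh c) (dec c)" if "c \<in> ?G" for c
  proof -
    show b: "ballot {1..n} (sh c)" using that ballot_shift_iff_dominating by (simp add: sh_def)
    show "encodes {1..n} (sh c) (dec c)"
      unfolding dec_def by (rule theI', rule ballot_encodes_unique) (use b in auto)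
    have "sum c {..<n} + c n = n" "n \<le> sum c {..<n}"
      using that by (auto simp: weak_compositions_def dominating_def)
    then show "c n = 0" by simp
  qed
  have bij: "bij_betw dec ?G (NC n)"
    unfolding bij_betw_def
  proof
    show "inj_on dec ?G"
    proof
      fix c c' assume cc: "c \<in> ?G" "c' \<in> ?G" "dec c = dec c'"
      have "c i = c' i" if "i < n" for i
        using encodes_determines_word[OF G(3)[OF cc(1)], of "sh c'" "Suc i"] G(3)[OF cc(2)] cc(3) that
        by (simp add: sh_def)
      moreover have "c n = c' n" using G(1)[OF cc(1)] G(1)[OF cc(2)] by simp
      ultimately have "c i = c' i" if "i \<in> {..<Suc n}" for i
        using that by (auto simp: less_Suc_eq)
      then show "c = c'" using cc by (auto simp: weak_compositions_def intro: PiE_ext)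
    qed
    show "dec ` ?G = NC n"
    proof
      show "dec ` ?G \<subseteq> NC n" using G(3) by (auto simp: NC_def encodes_def)
      show "NC n \<subseteq> dec ` ?G"
      proof
        fix P assume "P \<in> NC n"
        then obtain w where w: "encodes {1..n} w P"
          using encodes_word_exists[of "{1..n}" P] by (auto simp: NC_def)
        define c where "c = (\<lambda>i\<in>{..<Suc n}. if i < n then w (Suc i) else 0)"
        have enc: "encodes {1..n} (sh c) P"
          by (rule encodes_cong[OF _ _ w]) (auto simp: sh_def c_def)
        then have b: "ballot {1..n} (sh c)" by (intro encodes_imp_ballot) auto
        then have "(\<Sum>v\<in>{1..n}. sh c v) = n" by (simp add: ballot_def)
        moreover have "(\<Sum>v\<in>{1..n}. sh c v) = sum c {..<n}"
          by (rule sum.reindex_bij_witness[of _ Suc "\<lambda>v. v - 1"]) (auto simp: sh_def)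
        ultimately have "c \<in> weak_compositions (Suc n) n"
          by (auto simp: weak_compositions_def c_def)
        then have "c \<in> ?G" using b ballot_shift_iff_dominating by (simp add: sh_def)
        moreover have "P = dec c"
          using ballot_encodes_unique[OF _ b] enc G(3)[OF \<open>c \<in> ?G\<close>] by blast
        ultimately show "P \<in> dec ` ?G" by blast
      qed
    qed
  qed
  have stat: "(\<Sum>A\<in>dec c. g (card A)) = (\<Sum>i<Suc n. g (c i))" if "c \<in> ?G" for c
  proof -
    have P: "partition_on {1..n} (dec c)" using G(3)[OF that] by (simp add: encodes_def)
    have "{B \<in> dec c. Min B \<in> {1..n}} = dec c" using partition_on_block(5)[OF P] by blast
    then have "(\<Sum>A\<in>dec c. g (card A)) = (\<Sum>v\<in>{1..n}. g (sh c v))"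
      using encodes_sum[OF _ G(3)[OF that] subset_refl, of g] g by simp
    also have "\<dots> = (\<Sum>i<n. g (c i))"
      by (rule sum.reindex_bij_witness[of _ Suc "\<lambda>v. v - 1"]) (auto simp: sh_def)
    finally show ?thesis using G(1)[OF that] g by simp
  qed
  have "(\<Sum>P\<in>NC n. h (\<Sum>A\<in>P. g (card A))) = (\<Sum>c\<in>?G. h (\<Sum>A\<in>dec c. g (card A)))"
    by (rule sum.reindex_bij_betw[OF bij, symmetric])
  also have "\<dots> = (\<Sum>c\<in>?G. h (\<Sum>i<Suc n. g (c i)))"
    by (rule sum.cong) (auto simp only: stat)
  finally show ?thesis .
qed

text \<open>The number of blocks of size \<open>l\<close> is distributed like the number of letters \<open>l\<close> in a uniformly
  random weak composition of \<open>n\<close> into \<open>n + 1\<close> parts. The factor \<open>n + 1\<close> from the cycle lemma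
  cancels in the quotient.\<close>
theorem expectation_random_NC:
  fixes h :: "real \<Rightarrow> complex" and n :: nat
  assumes l: "l \<ge> 1"
  defines "W \<equiv> weak_compositions (Suc n) n"
  shows "measure_pmf.expectation (random_NC n) (\<lambda>P. h (num_blocks l P)) =
    (\<Sum>c\<in>W. h (\<Sum>i<Suc n. of_bool (c i = l))) / (\<Sum>c\<in>W. 1)"
proof -
  have nb: "num_blocks l P = (\<Sum>A\<in>P. of_bool (card A = l))" if "P \<in> NC n" for P
  proof -
    have "finite P" using that finite_elements by (auto simp: NC_def)
    then show ?thesis by (simp add: num_blocks_def sum.If_cases of_bool_def Int_def)
  qed
  have eq: "(\<Sum>c\<in>W. h' (\<Sum>i<Suc n. of_bool (c i = l))) = of_nat (Suc n) * (\<Sum>P\<in>NC n. h' (num_blocks l P))"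
    for h' :: "real \<Rightarrow> complex"
  proof -
    have "(\<Sum>P\<in>NC n. h' (num_blocks l P)) = (\<Sum>P\<in>NC n. h' (\<Sum>A\<in>P. of_bool (card A = l)))"
      by (rule sum.cong) (auto simp: nb)
    then show ?thesis
      unfolding W_def sum_weak_compositions_cycle[of h' "\<lambda>k. of_bool (k = l)"]
      using sum_NC_eq_sum_dominating[of "\<lambda>k. of_bool (k = l)" h' n] l by simp
  qed
  have "measure_pmf.expectation (random_NC n) (\<lambda>P. h (num_blocks l P)) =
    (\<Sum>P\<in>NC n. h (num_blocks l P)) / of_nat (card (NC n))"
    unfolding random_NC_def
    by (subst integral_measure_pmf[OF finite_NC[of n]])
      (auto simp: NC_nonempty finite_NC scaleR_conv_of_real sum_distrib_left sum_divide_distrib)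
  also have "\<dots> = (of_nat (Suc n) * (\<Sum>P\<in>NC n. h (num_blocks l P))) / (of_nat (Suc n) * (\<Sum>P\<in>NC n. 1))"
    by (subst mult_divide_mult_cancel_left) (auto simp del: of_nat_Suc)
  finally show ?thesis unfolding eq[of h] eq[of "\<lambda>_. 1"] .
qed

section \<open>Fourier inversion for weak compositions\<close>

text \<open>The geometric distribution with mean \<open>1\<close>. All weak compositions of \<open>n\<close> into \<open>N\<close> parts have the
  same probability \<open>2 ^ -(n + N)\<close> under \<open>N\<close> independent letters of this distribution, and the mean
  is chosen so that the condition on the sum concerns the centre of the distribution.\<close>
definition geom :: "nat \<Rightarrow> real" where
  "geom k = (1/2) ^ Suc k"

lemma geom_pos: "geom k > 0"
  by (simp add: geom_def)

lemma geom_sums: "geom sums 1"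
  using power_half_series by (simp add: geom_def[abs_def])

definition transform_term :: "(nat \<Rightarrow> complex) \<Rightarrow> real \<Rightarrow> nat \<Rightarrow> complex" where
  "transform_term f \<theta> k = of_real (geom k) * f k * cis (\<theta> * (real k - 1))"

text \<open>The expectation of \<open>f k * exp (i \<theta> (k - 1))\<close> for a geometric letter \<open>k\<close>. The shift by \<open>1\<close> centres
  the letter.\<close>
definition transform :: "(nat \<Rightarrow> complex) \<Rightarrow> real \<Rightarrow> complex" where
  "transform f \<theta> = (\<Sum>k. transform_term f \<theta> k)"

lemma norm_transform_term: "norm (transform_term f \<theta> k) = geom k * norm (f k)"
  using geom_pos[of k] by (simp add: transform_term_def norm_mult)

lemma summable_norm_transform_term:
  assumes "\<And>k. norm (f k) \<le> B"
  shows "summable (\<lambda>k. norm (transform_term f \<theta> k))"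
proof (rule summable_comparison_test')
  show "summable (\<lambda>k. geom k * B)" using geom_sums by (intro summable_mult2) (rule sums_summable)
  show "norm (norm (transform_term f \<theta> k)) \<le> geom k * B" for k
    using assms[of k] geom_pos[of k] by (simp add: norm_transform_term)
qed

lemma transform_sums:
  assumes "\<And>k. norm (f k) \<le> B"
  shows "transform_term f \<theta> sums transform f \<theta>"
  unfolding transform_def
  by (rule summable_sums, rule summable_norm_cancel, rule summable_norm_transform_term[OF assms])

lemma measurable_transform_term [measurable]: "(\<lambda>\<theta>. transform_term f \<theta> k) \<in> borel_measurable borel"
  unfolding transform_term_def
  by (intro borel_measurable_continuous_onI continuous_intros)

lemma measurable_transform [measurable]: "transform f \<in> borel_measurable borel"
  unfolding transform_def[abs_def] by measurable

lemma measurable_cis [measurable]: "cis \<in> borel_measurable borel"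
  by (intro borel_measurable_continuous_onI continuous_intros)

lemma norm_partial_transform:
  assumes "\<And>k. norm (f k) \<le> B"
  shows "norm (\<Sum>k\<le>K. transform_term f \<theta> k) \<le> B"
proof -
  have B: "0 \<le> B" using norm_ge_zero[of "f 0"] assms[of 0] by linarith
  have "norm (\<Sum>k\<le>K. transform_term f \<theta> k) \<le> (\<Sum>k\<le>K. geom k * B)"
    using assms geom_pos by (intro sum_norm_le) (auto simp: norm_transform_term less_imp_le intro!: mult_left_mono)
  also have "\<dots> = (\<Sum>k\<le>K. geom k) * B" by (simp add: sum_distrib_right)
  also have "(\<Sum>k\<le>K. geom k) \<le> 1"
    using sum_le_suminf[of geom "{..K}"] geom_sums geom_pos
    by (auto simp: sums_iff less_imp_le)
  then have "(\<Sum>k\<le>K. geom k) * B \<le> 1 * B" using B by (rule mult_right_mono)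
  finally show ?thesis by simp
qed

lemma norm_transform_le:
  assumes "\<And>k. norm (f k) \<le> B"
  shows "norm (transform f \<theta>) \<le> B"
proof (rule Lim_norm_ubound)
  show "(\<lambda>K. \<Sum>k\<le>K. transform_term f \<theta> k) \<longlonglongrightarrow> transform f \<theta>"
    using transform_sums[OF assms] by (simp add: sums_def_le)
  show "\<forall>\<^sub>F K in sequentially. norm (\<Sum>k\<le>K. transform_term f \<theta> k) \<le> B"
    by (rule always_eventually, rule allI, rule norm_partial_transform[OF assms])
qed simp

lemma integral_cis_int:
  "(\<integral>\<theta>. indicator {-pi..pi} \<theta> *\<^sub>R cis (\<theta> * of_int m) \<partial>lborel) = (if m = 0 then 2 * pi else 0)"
proof (cases "m = 0")
  case True
  then show ?thesis by (simp add: scaleR_conv_of_real)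
next
  case False
  define F where "F \<theta> = cis (\<theta> * of_int m) / (\<i> * of_int m)" for \<theta> :: real
  have "(F has_vector_derivative cis (\<theta> * of_int m)) (at \<theta> within {-pi..pi})" for \<theta>
    unfolding F_def has_vector_derivative_def using False
    by (auto intro!: derivative_eq_intros simp: scaleR_conv_of_real field_simps)
  then have "(\<integral>\<theta>. indicator {-pi..pi} \<theta> *\<^sub>R cis (\<theta> * of_int m) \<partial>lborel) = F pi - F (-pi)"
    by (intro integral_FTC_atLeastAtMost) (auto intro!: continuous_intros)
  also have "\<dots> = 0"
  proof -
    have "cis (pi * of_int m) = cis (- pi * of_int m)"
      by (simp add: complex_eq_iff)
    then show ?thesis by (simp add: F_def)
  qed
  finally show ?thesis using False by simp
qed

text \<open>Expanding the product of the partial sums up to \<open>K \<ge> n\<close> gives a finite sum over words, from which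
  integration over \<open>\<theta>\<close> extracts the words of sum \<open>n\<close>; their contribution does not depend on
  \<open>K\<close>, so \<open>K\<close> can tend to infinity. The letters are shifted by \<open>1\<close> each, hence by \<open>N = n + 1\<close> in
  total; the factor \<open>cis \<theta>\<close> compensates for the difference between \<open>N\<close> and \<open>n\<close>.\<close>
theorem sum_weak_compositions_Fourier:
  fixes f :: "nat \<Rightarrow> nat \<Rightarrow> complex"
  assumes N: "N = Suc n" and bound: "\<And>j k. norm (f j k) \<le> B"
  shows "(\<Sum>c\<in>weak_compositions N n. \<Prod>j<N. of_real (geom (c j)) * f j (c j)) =
    1 / (2 * pi) * (\<integral>\<theta>. indicator {-pi..pi} \<theta> *\<^sub>R (cis \<theta> * (\<Prod>j<N. transform (f j) \<theta>)) \<partial>lborel)"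
proof -
  define S where "S = (\<Sum>c\<in>weak_compositions N n. \<Prod>j<N. of_real (geom (c j)) * f j (c j))"
  define G where "G K \<theta> = indicator {-pi..pi} \<theta> *\<^sub>R (cis \<theta> * (\<Prod>j<N. \<Sum>k\<le>K. transform_term (f j) \<theta> k))"
    for K \<theta>
  have B: "0 \<le> B" using norm_ge_zero[of "f 0 0"] bound[of 0 0] by linarith
  have G_integral: "(\<integral>\<theta>. G K \<theta> \<partial>lborel) = 2 * pi * S" if K: "K \<ge> n" for K
  proof -
    define w where "w c = (\<Prod>j<N. of_real (geom (c j)) * f j (c j))" for c
    have G_eq: "G K \<theta> = (\<Sum>c\<in>{..<N} \<rightarrow>\<^sub>E {..K}.
      w c * (indicator {-pi..pi} \<theta> *\<^sub>R cis (\<theta> * of_int (int (sum c {..<N}) - int n))))" for \<theta>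
    proof -
      have "cis \<theta> * (\<Prod>j<N. transform_term (f j) \<theta> (c j)) =
          w c * cis (\<theta> * of_int (int (sum c {..<N}) - int n))" for c
      proof -
        have "(\<Prod>j\<in>A. cis (\<theta> * (real (c j) - 1))) = cis (\<theta> * (real (sum c A) - real (card A)))"
          if "finite A" for A
          using that by (induction A rule: finite_induct) (auto simp: cis_mult algebra_simps)
        from this[of "{..<N}"]
        have "(\<Prod>j<N. transform_term (f j) \<theta> (c j)) = w c * cis (\<theta> * (real (sum c {..<N}) - real N))"
          by (simp add: transform_term_def w_def prod.distrib)
        then have "cis \<theta> * (\<Prod>j<N. transform_term (f j) \<theta> (c j)) =
          w c * (cis \<theta> * cis (\<theta> * (real (sum c {..<N}) - real N)))" by simp
        also have "cis \<theta> * cis (\<theta> * (real (sum c {..<N}) - real N)) =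
          cis (\<theta> * of_int (int (sum c {..<N}) - int n))"
          unfolding cis_mult by (rule arg_cong[where f = cis]) (simp add: N algebra_simps)
        finally show ?thesis .
      qed
      then show ?thesis
        unfolding G_def by (subst prod_sum_PiE) (simp_all add: sum_distrib_left scaleR_sum_right)
    qed
    have int: "integrable lborel (\<lambda>\<theta>. indicator {-pi..pi} \<theta> *\<^sub>R cis (\<theta> * of_int m))" for m
      by (rule borel_integrable_atLeastAtMost'[unfolded set_integrable_def]) (intro continuous_intros)
    have "(\<integral>\<theta>. G K \<theta> \<partial>lborel) = (\<Sum>c\<in>{..<N} \<rightarrow>\<^sub>E {..K}. w c *
      (\<integral>\<theta>. indicator {-pi..pi} \<theta> *\<^sub>R cis (\<theta> * of_int (int (sum c {..<N}) - int n)) \<partial>lborel))"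
      unfolding G_eq
      by (subst Bochner_Integration.integral_sum, intro integrable_mult_right int)
        (simp only: Bochner_Integration.integral_mult_right[OF int])
    also have "\<dots> = (\<Sum>c\<in>{..<N} \<rightarrow>\<^sub>E {..K}. if sum c {..<N} = n then 2 * pi * w c else 0)"
      unfolding integral_cis_int
    proof (rule sum.cong)
      fix c
      have "int (sum c {..<N}) - int n = 0 \<longleftrightarrow> sum c {..<N} = n" by linarith
      then show "w c * complex_of_real (if int (sum c {..<N}) - int n = 0 then 2 * pi else 0) =
        (if sum c {..<N} = n then 2 * pi * w c else 0)" by simp
    qed simp
    also have "\<dots> = (\<Sum>c | c \<in> {..<N} \<rightarrow>\<^sub>E {..K} \<and> sum c {..<N} = n. 2 * pi * w c)"
      by (rule sum.inter_filter[symmetric]) (auto intro: finite_PiE)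
    also have "{c. c \<in> {..<N} \<rightarrow>\<^sub>E {..K} \<and> sum c {..<N} = n} = weak_compositions N n"
    proof
      have "{..<N} \<rightarrow>\<^sub>E {..n} \<subseteq> {..<N} \<rightarrow>\<^sub>E {..K}" using K by (intro PiE_mono) auto
      then show "weak_compositions N n \<subseteq> {c. c \<in> {..<N} \<rightarrow>\<^sub>E {..K} \<and> sum c {..<N} = n}"
        using weak_compositions_subset[of N n] by (auto simp: weak_compositions_def)
    qed (auto simp: weak_compositions_def PiE_iff)
    finally show ?thesis by (simp add: S_def w_def sum_distrib_left)
  qed
  have "(\<lambda>K. \<integral>\<theta>. G K \<theta> \<partial>lborel) \<longlonglongrightarrow>
    (\<integral>\<theta>. indicator {-pi..pi} \<theta> *\<^sub>R (cis \<theta> * (\<Prod>j<N. transform (f j) \<theta>)) \<partial>lborel)"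
  proof (rule integral_dominated_convergence[where w = "\<lambda>\<theta>. indicator {-pi..pi} \<theta> * B ^ N"])
    show "integrable lborel (\<lambda>\<theta>. indicator {-pi..pi} \<theta> * B ^ N :: real)"
      using borel_integrable_atLeastAtMost'[unfolded set_integrable_def, of "-pi" pi "\<lambda>_. B ^ N"]
      by simp
    show "AE \<theta> in lborel. (\<lambda>K. G K \<theta>) \<longlonglongrightarrow>
      indicator {-pi..pi} \<theta> *\<^sub>R (cis \<theta> * (\<Prod>j<N. transform (f j) \<theta>))"
    proof (rule AE_I2)
      fix \<theta> :: real
      have "(\<lambda>K. \<Sum>k\<le>K. transform_term (f j) \<theta> k) \<longlonglongrightarrow> transform (f j) \<theta>" for j
        using transform_sums[OF bound] by (simp add: sums_def_le)
      then show "(\<lambda>K. G K \<theta>) \<longlonglongrightarrow> indicator {-pi..pi} \<theta> *\<^sub>R (cis \<theta> * (\<Prod>j<N. transform (f j) \<theta>))"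
        unfolding G_def by (intro tendsto_intros)
    qed
    show "AE \<theta> in lborel. norm (G K \<theta>) \<le> indicator {-pi..pi} \<theta> * B ^ N" for K
    proof (rule AE_I2)
      fix \<theta> :: real
      have "norm (\<Prod>j<N. \<Sum>k\<le>K. transform_term (f j) \<theta> k) \<le> (\<Prod>j<N. B)"
        unfolding prod_norm[symmetric]
        by (rule prod_mono) (auto intro: norm_partial_transform[OF bound])
      then show "norm (G K \<theta>) \<le> indicator {-pi..pi} \<theta> * B ^ N"
        by (auto simp: G_def norm_mult indicator_def)
    qed
  qed (unfold G_def, measurable)
  moreover have "(\<lambda>K. \<integral>\<theta>. G K \<theta> \<partial>lborel) \<longlonglongrightarrow> 2 * pi * S"
    using G_integral by (intro tendsto_eventually eventually_sequentiallyI[of n])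
  ultimately have "(\<integral>\<theta>. indicator {-pi..pi} \<theta> *\<^sub>R (cis \<theta> * (\<Prod>j<N. transform (f j) \<theta>)) \<partial>lborel) = 2 * pi * S"
    by (rule LIMSEQ_unique)
  then show ?thesis unfolding S_def by simp
qed

section \<open>Taylor expansion and decay of the characteristic functions\<close>

text \<open>One constant dominates the first three absolute moments of \<open>k - 1\<close> and serves in all error
  terms below.\<close>
definition moment_bound :: real where
  "moment_bound = (\<Sum>k. geom k * (real k + 1) ^ 3)"

lemma moment_bound_sums: "(\<lambda>k. geom k * (real k + 1) ^ 3) sums moment_bound"
proof -
  have "summable (\<lambda>k. geom k * (real k + 1) ^ 3)"
  proof (rule summable_comparison_test_bigo)
    show "summable (\<lambda>k. norm ((3/4) ^ k :: real))" by (simp add: summable_geometric)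
    show "(\<lambda>k. geom k * (real k + 1) ^ 3) \<in> O(\<lambda>k. (3/4) ^ k)"
      unfolding geom_def by real_asymp
  qed
  then show ?thesis unfolding moment_bound_def by (rule summable_sums)
qed

lemma moment_bound_nonneg: "0 \<le> moment_bound"
proof (rule sums_le[OF _ sums_zero moment_bound_sums])
  show "0 \<le> geom k * (real k + 1) ^ 3" for k using geom_pos[of k] by simp
qed

lemma geom_first_moment: "(\<lambda>k. geom k * (real k - 1)) sums 0"
proof -
  \<comment> \<open>the series telescopes: this is its sequence of tails\<close>
  have "(\<lambda>k. real k * (1/2) ^ k) \<longlonglongrightarrow> 0" by real_asymp
  from telescope_sums'[OF this]
  have "(\<lambda>k. real k * (1/2) ^ k - real (Suc k) * (1/2) ^ Suc k) sums 0" by simp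
  then show ?thesis by (rule sums_cong[THEN iffD1, rotated]) (simp add: geom_def field_simps)
qed

lemma geom_second_moment: "(\<lambda>k. geom k * (real k - 1) ^ 2) sums 2"
proof -
  \<comment> \<open>again the tails of the series\<close>
  have "(\<lambda>k. (real k ^ 2 + 2) * (1/2) ^ k) \<longlonglongrightarrow> 0" by real_asymp
  from telescope_sums'[OF this]
  have "(\<lambda>k. (real k ^ 2 + 2) * (1/2) ^ k - (real (Suc k) ^ 2 + 2) * (1/2) ^ Suc k) sums 2" by simp
  then show ?thesis
    by (rule sums_cong[THEN iffD1, rotated]) (simp add: geom_def field_simps power2_eq_square)
qed

text \<open>The indicator of the letter \<open>l\<close>, centred with respect to the geometric distribution.\<close>
definition centered :: "nat \<Rightarrow> nat \<Rightarrow> real" where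
  "centered l k = of_bool (k = l) - geom l"

lemma geom_le_1: "geom l \<le> 1"
  unfolding geom_def by (rule power_le_one) auto

lemma centered_le_1: "\<bar>centered l k\<bar> \<le> 1"
  using geom_pos[of l] geom_le_1[of l] by (auto simp: centered_def)

text \<open>Multiplying by the centred indicator turns a moment series with sum \<open>V\<close> into an explicit one,
  which yields all mixed moments that are needed.\<close>
lemma centered_sums_times:
  assumes "(\<lambda>k. geom k * v k) sums V"
  shows "(\<lambda>k. geom k * (centered l k * v k)) sums (geom l * (v l - V))"
proof -
  have "(\<lambda>k. if k = l then geom k * v k else 0) sums (geom l * v l)" by (rule sums_single)
  from sums_diff[OF this sums_mult[OF assms, of "geom l"]]
  have "(\<lambda>k. (if k = l then geom k * v k else 0) - geom l * (geom k * v k)) sums (geom l * (v l - V))"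
    by (simp add: algebra_simps)
  then show ?thesis
    by (rule sums_cong[THEN iffD1, rotated]) (simp add: centered_def algebra_simps)
qed

lemma centered_first_moment: "(\<lambda>k. geom k * centered l k) sums 0"
  using centered_sums_times[of "\<lambda>_. 1" 1 l] geom_sums by simp

definition block_cov :: "nat \<Rightarrow> real" where
  "block_cov l = geom l * (real l - 1)"

definition block_var :: "nat \<Rightarrow> real" where
  "block_var l = geom l * (1 - geom l)"

lemma centered_covariance: "(\<lambda>k. geom k * (centered l k * (real k - 1))) sums block_cov l"
  using centered_sums_times[OF geom_first_moment, of l] by (simp add: block_cov_def)

lemma centered_variance: "(\<lambda>k. geom k * (centered l k * centered l k)) sums block_var l"
  using centered_sums_times[OF centered_first_moment, of l l]
  by (simp add: block_var_def) (simp add: centered_def)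

text \<open>Termwise Taylor expansion of a series of exponentials: the error of order \<open>n + 1 \<le> 3\<close> is absorbed
  by the third moment.\<close>
lemma iexp_taylor_sums:
  assumes n: "n \<le> 2" and v: "\<And>k. norm (v k) \<le> 1"
    and x: "\<And>k. \<bar>x k\<bar> \<le> r * (real k + 1)"
    and T: "(\<lambda>k. of_real (geom k) * v k * cis (x k)) sums T"
    and L: "(\<lambda>k. of_real (geom k) * v k * (\<Sum>j\<le>n. (\<i> * of_real (x k)) ^ j / fact j)) sums L"
  shows "norm (T - L) \<le> r ^ Suc n * moment_bound"
proof (rule norm_sums_le[OF sums_diff[OF T L] sums_mult[OF moment_bound_sums]])
  have r: "0 \<le> r" using order_trans[OF abs_ge_zero x[of 0]] by simp
  fix k
  let ?p = "\<Sum>j\<le>n. (\<i> * of_real (x k)) ^ j / fact j"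
  have "norm (cis (x k) - ?p) \<le> \<bar>x k\<bar> ^ Suc n / fact (Suc n)"
    using iexp_approx1[of "x k" n] by (simp only: cis_conv_exp)
  also have "\<dots> \<le> \<bar>x k\<bar> ^ Suc n"
    using divide_left_mono[OF fact_ge_1[of "Suc n"], of "\<bar>x k\<bar> ^ Suc n"]
    by (simp del: fact_Suc power_Suc)
  also have "\<dots> \<le> (r * (real k + 1)) ^ Suc n" by (intro power_mono x) auto
  also have "\<dots> = r ^ Suc n * (real k + 1) ^ Suc n" by (rule power_mult_distrib)
  also have "\<dots> \<le> r ^ Suc n * (real k + 1) ^ 3"
    using n r by (intro mult_left_mono power_increasing) auto
  finally have *: "norm (cis (x k) - ?p) \<le> r ^ Suc n * (real k + 1) ^ 3" .
  have "norm (of_real (geom k) * v k * cis (x k) - of_real (geom k) * v k * ?p) =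
    geom k * (norm (v k) * norm (cis (x k) - ?p))"
    using geom_pos[of k] by (simp only: right_diff_distrib[symmetric] norm_mult) simp
  also have "\<dots> \<le> geom k * (1 * (r ^ Suc n * (real k + 1) ^ 3))"
    using geom_pos[of k] * v[of k] by (intro mult_left_mono mult_mono) auto
  finally show "norm (of_real (geom k) * v k * cis (x k) - of_real (geom k) * v k * ?p) \<le>
    r ^ Suc n * (geom k * (real k + 1) ^ 3)" by (simp only: mult.assoc mult.left_commute mult_1_left)
qed

text \<open>The joint characteristic function of the centred indicator of the letter \<open>l\<close> and the centred
  letter \<open>k - 1\<close>.\<close>
definition char_fun :: "nat \<Rightarrow> real \<Rightarrow> real \<Rightarrow> complex" where
  "char_fun l s = transform (\<lambda>k. cis (s * centered l k))"

text \<open>The quadratic form of the covariance matrix of the centred indicator and the centred letter, whose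
  variance is \<open>2\<close>.\<close>
definition quad :: "nat \<Rightarrow> real \<Rightarrow> real \<Rightarrow> real" where
  "quad l s u = s\<^sup>2 * block_var l + 2 * s * u * block_cov l + 2 * u\<^sup>2"

lemma quad_sums: "(\<lambda>k. geom k * (s * centered l k + u * (real k - 1))\<^sup>2) sums quad l s u"
proof -
  have "(\<lambda>k. s\<^sup>2 * (geom k * (centered l k * centered l k)) +
      2 * s * u * (geom k * (centered l k * (real k - 1))) + u\<^sup>2 * (geom k * (real k - 1)\<^sup>2)) sums
    (s\<^sup>2 * block_var l + 2 * s * u * block_cov l + u\<^sup>2 * 2)"
    by (intro sums_add sums_mult centered_variance centered_covariance geom_second_moment)
  moreover have "s\<^sup>2 * block_var l + 2 * s * u * block_cov l + u\<^sup>2 * 2 = quad l s u"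
    by (simp add: quad_def)
  ultimately show ?thesis
    by (auto elim!: sums_cong[THEN iffD1, rotated] simp: power2_eq_square algebra_simps)
qed

lemma quad_nonneg: "0 \<le> quad l s u"
  by (rule sums_le[OF _ sums_zero quad_sums]) (use geom_pos in \<open>simp add: less_imp_le\<close>)

lemma char_fun_taylor:
  "norm (char_fun l s \<theta> - of_real (1 - quad l s \<theta> / 2)) \<le> (\<bar>s\<bar> + \<bar>\<theta>\<bar>) ^ 3 * moment_bound"
proof -
  define x where "x k = s * centered l k + \<theta> * (real k - 1)" for k
  have T: "(\<lambda>k. of_real (geom k) * 1 * cis (x k)) sums char_fun l s \<theta>"
    using transform_sums[of "\<lambda>k. cis (s * centered l k)" 1 \<theta>]
    by (simp add: char_fun_def transform_term_def[abs_def] x_def cis_mult mult.assoc)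
  have m1: "(\<lambda>k. geom k * x k) sums 0"
  proof -
    have "(\<lambda>k. s * (geom k * centered l k) + \<theta> * (geom k * (real k - 1))) sums (s * 0 + \<theta> * 0)"
      by (intro sums_add sums_mult centered_first_moment geom_first_moment)
    then show ?thesis by (simp add: x_def algebra_simps)
  qed
  have "(\<lambda>k. of_real (geom k) + \<i> * of_real (geom k * x k) - of_real (geom k * (x k)\<^sup>2) / 2)
    sums (of_real 1 + \<i> * of_real 0 - of_real (quad l s \<theta>) / 2)"
    unfolding x_def
    by (intro sums_add sums_diff sums_mult sums_divide sums_of_real geom_sums quad_sums m1[unfolded x_def])
  then have L: "(\<lambda>k. of_real (geom k) * 1 * (\<Sum>j\<le>2. (\<i> * of_real (x k)) ^ j / fact j)) sums
    of_real (1 - quad l s \<theta> / 2)"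
    by (simp add: eval_nat_numeral algebra_simps)
  have x: "\<bar>x k\<bar> \<le> (\<bar>s\<bar> + \<bar>\<theta>\<bar>) * (real k + 1)" for k
  proof -
    have "\<bar>x k\<bar> \<le> \<bar>s\<bar> * \<bar>centered l k\<bar> + \<bar>\<theta>\<bar> * \<bar>real k - 1\<bar>"
      unfolding x_def abs_mult[symmetric] by (rule abs_triangle_ineq)
    also have "\<dots> \<le> \<bar>s\<bar> * (real k + 1) + \<bar>\<theta>\<bar> * (real k + 1)"
      using centered_le_1[of l k] by (intro add_mono mult_left_mono) auto
    finally show ?thesis by (simp add: algebra_simps)
  qed
  from iexp_taylor_sums[OF _ _ x T L] show ?thesis by (simp add: eval_nat_numeral)
qed

text \<open>These transforms replace a factor \<open>char_fun l 0\<close> in the Fourier integral when a moment of the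
  indicator at one position is inserted.\<close>
definition centered_transform :: "nat \<Rightarrow> nat \<Rightarrow> real \<Rightarrow> complex" where
  "centered_transform m l = transform (\<lambda>k. of_real (centered l k ^ m))"

lemma centered_transform_sums:
  "(\<lambda>k. of_real (geom k) * of_real (centered l k ^ m) * cis (\<theta> * (real k - 1))) sums centered_transform m l \<theta>"
  using transform_sums[of "\<lambda>k. of_real (centered l k ^ m)" 1 \<theta>] centered_le_1
  by (simp add: centered_transform_def transform_term_def[abs_def] power_abs power_le_one norm_power)

lemma power_centered_le_1: "norm (complex_of_real (centered l k ^ m)) \<le> 1"
  using centered_le_1 by (simp add: norm_power power_abs power_le_one)

lemma abs_times_shift_le: "\<bar>\<theta> * (real k - 1)\<bar> \<le> \<bar>\<theta>\<bar> * (real k + 1)"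
  unfolding abs_mult by (rule mult_left_mono) auto

lemma centered_transform_1_bound: "norm (centered_transform 1 l \<theta>) \<le> \<bar>\<theta>\<bar> * moment_bound"
proof -
  have "(\<lambda>k. of_real (geom k * centered l k)) sums (of_real 0 :: complex)"
    by (intro sums_of_real centered_first_moment)
  then have L: "(\<lambda>k. of_real (geom k) * of_real (centered l k ^ 1) *
      (\<Sum>j\<le>0. (\<i> * of_real (\<theta> * (real k - 1))) ^ j / fact j)) sums (0::complex)"
    by simp
  show ?thesis
    using iexp_taylor_sums[OF _ power_centered_le_1 abs_times_shift_le centered_transform_sums L] by simp
qed

lemma centered_transform_1_taylor:
  "norm (centered_transform 1 l \<theta> - \<i> * of_real (\<theta> * block_cov l)) \<le> \<theta>\<^sup>2 * moment_bound"
proof -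
  have "(\<lambda>k. of_real (geom k * centered l k) + \<i> * of_real \<theta> * of_real (geom k * (centered l k * (real k - 1))))
    sums (of_real 0 + \<i> * of_real \<theta> * of_real (block_cov l))"
    by (intro sums_add sums_mult sums_of_real centered_first_moment centered_covariance)
  then have L: "(\<lambda>k. of_real (geom k) * of_real (centered l k ^ 1) *
      (\<Sum>j\<le>1. (\<i> * of_real (\<theta> * (real k - 1))) ^ j / fact j)) sums (\<i> * of_real (\<theta> * block_cov l))"
    by (simp add: algebra_simps)
  show ?thesis
    using iexp_taylor_sums[OF _ power_centered_le_1 abs_times_shift_le centered_transform_sums L]
    by (simp add: power2_eq_square)
qed

lemma centered_transform_2_taylor:
  "norm (centered_transform 2 l \<theta> - of_real (block_var l)) \<le> \<bar>\<theta>\<bar> * moment_bound"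
proof -
  have "(\<lambda>k. of_real (geom k * (centered l k * centered l k))) sums (of_real (block_var l) :: complex)"
    by (intro sums_of_real centered_variance)
  then have L: "(\<lambda>k. of_real (geom k) * of_real (centered l k ^ 2) *
      (\<Sum>j\<le>0. (\<i> * of_real (\<theta> * (real k - 1))) ^ j / fact j)) sums (of_real (block_var l)::complex)"
    by (simp add: power2_eq_square)
  show ?thesis
    using iexp_taylor_sums[OF _ power_centered_le_1 abs_times_shift_le centered_transform_sums L] by simp
qed

lemma centered_transform_2_bound: "norm (centered_transform 2 l \<theta>) \<le> 1"
  unfolding centered_transform_def by (rule norm_transform_le) (rule power_centered_le_1)

text \<open>The divisor is \<open>18 = 12 * 3 / 2\<close>, from the constants \<open>1 / 12\<close> and \<open>2 / 3\<close> in the next two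
  estimates, rounded up.\<close>
definition decay :: "nat \<Rightarrow> real" where
  "decay m = geom (Suc m) / 20"

text \<open>The Taylor bound \<open>1 - cos \<theta> \<ge> \<theta>\<^sup>2 / 2 - \<theta> ^ 4 / 24\<close> suffices because \<open>pi\<^sup>2 \<le> 10\<close>.\<close>
lemma one_minus_cos_ge:
  assumes "\<bar>\<theta>\<bar> \<le> pi"
  shows "1 - cos \<theta> \<ge> \<theta>\<^sup>2 / 12"
proof -
  have "norm (iexp \<theta> - (\<Sum>k\<le>3. (\<i> * \<theta>) ^ k / fact k)) \<le> \<bar>\<theta>\<bar> ^ 4 / 24"
    using iexp_approx1[of \<theta> 3] by (simp add: fact_numeral eval_nat_numeral)
  then have "\<bar>Re (iexp \<theta> - (\<Sum>k\<le>3. (\<i> * \<theta>) ^ k / fact k))\<bar> \<le> \<bar>\<theta>\<bar> ^ 4 / 24"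
    using abs_Re_le_cmod order_trans by blast
  moreover have "Re (iexp \<theta> - (\<Sum>k\<le>3. (\<i> * \<theta>) ^ k / fact k)) = cos \<theta> - (1 - \<theta>\<^sup>2 / 2)"
    by (simp add: eval_nat_numeral Re_exp)
  ultimately have "1 - cos \<theta> \<ge> \<theta>\<^sup>2 / 2 - \<bar>\<theta>\<bar> ^ 4 / 24" by linarith
  also have "\<bar>\<theta>\<bar> ^ 4 = \<theta>\<^sup>2 * \<theta>\<^sup>2" by (simp add: eval_nat_numeral)
  moreover have "\<theta>\<^sup>2 \<le> 10"
  proof -
    have "pi \<le> 3.15" using pi_approx(2) by simp
    then have "\<bar>\<theta>\<bar> ^ 2 \<le> 3.15 ^ 2" using assms by (intro power_mono) auto
    then show ?thesis by (simp add: power2_eq_square)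
  qed
  then have "\<theta>\<^sup>2 * \<theta>\<^sup>2 \<le> \<theta>\<^sup>2 * 10" by (intro mult_left_mono) auto
  ultimately show ?thesis by simp
qed

lemma norm_two_plus_cis: "norm (2 + cis \<theta>) \<le> 3 - 2 / 3 * (1 - cos \<theta>)"
proof (rule power2_le_imp_le)
  have "(norm (2 + cis \<theta>))\<^sup>2 = 5 + 4 * cos \<theta>"
    by (simp add: cmod_power2) (simp add: power2_eq_square algebra_simps)
  also have "\<dots> \<le> (3 - 2 / 3 * (1 - cos \<theta>))\<^sup>2"
    using zero_le_power2[of "1 - cos \<theta>"] by (simp add: power2_eq_square algebra_simps)
  finally show "(norm (2 + cis \<theta>))\<^sup>2 \<le> (3 - 2 / 3 * (1 - cos \<theta>))\<^sup>2" .
  have "1 - cos \<theta> \<le> 2" using cos_ge_minus_one[of \<theta>] by linarith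
  then have "2 / 3 * (1 - cos \<theta>) \<le> 2 / 3 * 2" by (rule mult_left_mono) simp
  then show "0 \<le> 3 - 2 / 3 * (1 - cos \<theta>)" by linarith
qed

text \<open>Two neighbouring letters with the same coefficient already force the decay: their contributions
  to the transform are out of phase by \<open>\<theta>\<close>, and everything else is estimated trivially.\<close>
lemma transform_decay:
  assumes f: "\<And>k. norm (f k) \<le> 1" and eq: "f (Suc m) = f m" and \<theta>: "\<bar>\<theta>\<bar> \<le> pi"
  shows "norm (transform f \<theta>) \<le> exp (- decay m * \<theta>\<^sup>2)"
proof -
  let ?q = "geom (Suc m)"
  have two: "norm (transform_term f \<theta> m + transform_term f \<theta> (Suc m)) \<le> ?q * (3 - 2 / 3 * (1 - cos \<theta>))"
  proof -
    have gm: "geom m = 2 * ?q" by (simp add: geom_def)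
    have "cis (\<theta> * (real (Suc m) - 1)) = cis (\<theta> * (real m - 1)) * cis \<theta>"
      by (simp add: cis_mult algebra_simps)
    then have "transform_term f \<theta> m + transform_term f \<theta> (Suc m) =
      of_real ?q * f m * cis (\<theta> * (real m - 1)) * (2 + cis \<theta>)"
      unfolding transform_term_def eq gm by (simp only:) (simp add: algebra_simps)
    then have "norm (transform_term f \<theta> m + transform_term f \<theta> (Suc m)) = ?q * (norm (f m) * norm (2 + cis \<theta>))"
      using geom_pos[of "Suc m"] by (simp add: norm_mult)
    also have "\<dots> \<le> ?q * (1 * norm (2 + cis \<theta>))"
      using geom_pos[of "Suc m"] f[of m] by (intro mult_left_mono mult_right_mono) auto
    also have "\<dots> \<le> ?q * (3 - 2 / 3 * (1 - cos \<theta>))"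
      using geom_pos[of "Suc m"] norm_two_plus_cis[of \<theta>] by (intro mult_left_mono) auto
    finally show ?thesis .
  qed
  have "norm (transform f \<theta>) \<le> 1 - 2 / 3 * ?q * (1 - cos \<theta>)"
  proof (rule Lim_norm_ubound)
    show "(\<lambda>K. \<Sum>k\<le>K. transform_term f \<theta> k) \<longlonglongrightarrow> transform f \<theta>"
      using transform_sums[OF f] by (simp add: sums_def_le)
    show "\<forall>\<^sub>F K in sequentially. norm (\<Sum>k\<le>K. transform_term f \<theta> k) \<le> 1 - 2 / 3 * ?q * (1 - cos \<theta>)"
    proof (rule eventually_sequentiallyI)
      fix K assume K: "Suc m \<le> K"
      have split: "sum h {..K} = (h m + h (Suc m)) + sum h ({..K} - {m, Suc m})" for h :: "nat \<Rightarrow> 'z::comm_monoid_add"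
      proof -
        have "sum h {..K} = sum h ({..K} - {m, Suc m}) + sum h {m, Suc m}"
          by (rule sum.subset_diff) (use K in auto)
        then show ?thesis by (simp add: add.commute)
      qed
      have "norm (\<Sum>k\<le>K. transform_term f \<theta> k) \<le>
        norm (transform_term f \<theta> m + transform_term f \<theta> (Suc m)) + norm (sum (transform_term f \<theta>) ({..K} - {m, Suc m}))"
        unfolding split[of "transform_term f \<theta>"] by (rule norm_triangle_ineq)
      also have "norm (sum (transform_term f \<theta>) ({..K} - {m, Suc m})) \<le> sum geom ({..K} - {m, Suc m})"
        using f geom_pos by (intro sum_norm_le) (simp add: norm_transform_term mult_left_le less_imp_le)
      also have "\<dots> = sum geom {..K} - 3 * ?q"
        unfolding split[of geom] by (simp add: geom_def)
      also have "sum geom {..K} \<le> 1"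
        using sum_le_suminf[of geom "{..K}"] geom_sums geom_pos by (auto simp: sums_iff less_imp_le)
      finally show "norm (\<Sum>k\<le>K. transform_term f \<theta> k) \<le> 1 - 2 / 3 * ?q * (1 - cos \<theta>)"
        using two by (simp add: algebra_simps)
    qed
  qed simp
  also have "\<dots> \<le> 1 - decay m * \<theta>\<^sup>2"
  proof -
    have "?q * (\<theta>\<^sup>2 / 12) \<le> ?q * (1 - cos \<theta>)"
      using geom_pos[of "Suc m"] one_minus_cos_ge[OF \<theta>] by (intro mult_left_mono) auto
    moreover have "0 \<le> ?q * \<theta>\<^sup>2" using geom_pos[of "Suc m"] by simp
    ultimately show ?thesis by (simp add: decay_def)
  qed
  also have "\<dots> \<le> exp (- decay m * \<theta>\<^sup>2)"
    using exp_ge_add_one_self[of "- decay m * \<theta>\<^sup>2"] by simp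
  finally show ?thesis .
qed

text \<open>The letters \<open>l + 1\<close> and \<open>l + 2\<close> have the same coefficient, whatever \<open>s\<close> is; therefore the bound is
  uniform in \<open>s\<close>.\<close>
lemma char_fun_decay:
  assumes "\<bar>\<theta>\<bar> \<le> pi"
  shows "norm (char_fun l s \<theta>) \<le> exp (- decay (Suc l) * \<theta>\<^sup>2)"
  unfolding char_fun_def using assms by (intro transform_decay) (auto simp: centered_def)

section \<open>Limits of the rescaled Fourier integrals\<close>

text \<open>The complex version of \<open>(1 + L / n) ^ n \<longlonglongrightarrow> exp L\<close>, by comparison of powers of numbers in the
  closed unit disc.\<close>
lemma power_tendsto_exp:
  fixes z :: "nat \<Rightarrow> complex" and L :: real
  assumes z: "\<And>n. norm (z n) \<le> 1" and L: "L \<le> 0"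
    and lim: "(\<lambda>n. of_nat n * (z n - 1)) \<longlonglongrightarrow> of_real L"
  shows "(\<lambda>n. z n ^ n) \<longlonglongrightarrow> of_real (exp L)"
proof (rule Lim_transform)
  show "(\<lambda>n. complex_of_real ((1 + L / real n) ^ n)) \<longlonglongrightarrow> of_real (exp L)"
    by (intro tendsto_of_real tendsto_exp_limit_sequentially)
  have "(\<lambda>n. norm (of_nat n * (z n - 1) - of_real L)) \<longlonglongrightarrow> 0"
    using tendsto_norm[OF tendsto_diff[OF lim tendsto_const[of "of_real L"]]] by simp
  moreover have "\<forall>\<^sub>F n in sequentially. norm (z n ^ n - complex_of_real ((1 + L / real n) ^ n)) \<le>
    norm (of_nat n * (z n - 1) - of_real L)"
  proof (rule eventually_sequentiallyI)
    fix n assume n: "n \<ge> Suc (nat \<lceil>- L\<rceil>)"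
    then have "real n \<ge> - L" "n > 0" by linarith+
    then have "- 1 \<le> L / real n" "L / real n \<le> 0" using L by (auto simp: field_simps)
    then have w: "norm (complex_of_real (1 + L / real n)) \<le> 1"
      unfolding norm_of_real by linarith
    have "norm (z n ^ n - complex_of_real (1 + L / real n) ^ n) \<le> n * norm (z n - complex_of_real (1 + L / real n))"
      by (rule norm_power_diff[OF z w])
    also have "\<dots> = norm (of_nat n * (z n - complex_of_real (1 + L / real n)))" by (simp add: norm_mult)
    also have "of_nat n * (z n - complex_of_real (1 + L / real n)) = of_nat n * (z n - 1) - of_real L"
      using \<open>n > 0\<close> by (simp add: field_simps)
    finally show "norm (z n ^ n - complex_of_real ((1 + L / real n) ^ n)) \<le> norm (of_nat n * (z n - 1) - of_real L)"
      by simp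
  qed
  ultimately show "(\<lambda>n. z n ^ n - complex_of_real ((1 + L / real n) ^ n)) \<longlonglongrightarrow> 0"
    by (rule Lim_null_comparison[rotated])
qed

lemma norm_char_fun_le_1: "norm (char_fun l s \<theta>) \<le> 1"
  unfolding char_fun_def by (rule norm_transform_le) simp

lemma inverse_sqrt_tendsto_0: "(\<lambda>N. a / sqrt (real N)) \<longlonglongrightarrow> 0"
  by real_asymp

text \<open>The central limit theorem for the unconditioned pair of sums, at arguments that may vary with
  \<open>N\<close>.\<close>
lemma char_fun_power_limit:
  assumes t: "t \<longlonglongrightarrow> t0"
  shows "(\<lambda>N. char_fun l (t N / sqrt N) (u / sqrt N) ^ N) \<longlonglongrightarrow> of_real (exp (- quad l t0 u / 2))"
proof (rule power_tendsto_exp)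
  show "- quad l t0 u / 2 \<le> 0" using quad_nonneg by simp
  show "norm (char_fun l (t N / sqrt N) (u / sqrt N)) \<le> 1" for N by (rule norm_char_fun_le_1)
  show "(\<lambda>N. of_nat N * (char_fun l (t N / sqrt N) (u / sqrt N) - 1)) \<longlonglongrightarrow> of_real (- quad l t0 u / 2)"
  proof (rule Lim_transform)
    show "(\<lambda>N. complex_of_real (- quad l (t N) u / 2)) \<longlonglongrightarrow> of_real (- quad l t0 u / 2)"
      unfolding quad_def by (intro tendsto_intros t) simp
    have "(\<lambda>N. (\<bar>t N\<bar> + \<bar>u\<bar>) ^ 3 * (moment_bound / sqrt N)) \<longlonglongrightarrow> (\<bar>t0\<bar> + \<bar>u\<bar>) ^ 3 * 0"
      by (intro tendsto_intros t inverse_sqrt_tendsto_0)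
    then have "(\<lambda>N. (\<bar>t N\<bar> + \<bar>u\<bar>) ^ 3 * (moment_bound / sqrt N)) \<longlonglongrightarrow> 0" by simp
    moreover have "\<forall>\<^sub>F N in sequentially. norm (of_nat N * (char_fun l (t N / sqrt N) (u / sqrt N) - 1) -
        complex_of_real (- quad l (t N) u / 2)) \<le> (\<bar>t N\<bar> + \<bar>u\<bar>) ^ 3 * (moment_bound / sqrt N)"
    proof (rule eventually_sequentiallyI)
      fix N assume N: "(1::nat) \<le> N"
      define r where "r = sqrt N"
      have r: "r > 0" "real N = r * r" using N by (auto simp: r_def)
      have q: "quad l (t N / r) (u / r) = quad l (t N) u / (r * r)"
        using r(1) by (simp add: quad_def field_simps power2_eq_square)
      have "of_nat N * (char_fun l (t N / r) (u / r) - 1) - complex_of_real (- quad l (t N) u / 2) =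
        of_real (r * r) * (char_fun l (t N / r) (u / r) - of_real (1 - quad l (t N / r) (u / r) / 2))"
      proof -
        have "(of_nat N :: complex) = of_real (r * r)" using r(2) by (metis of_real_of_nat_eq)
        moreover have "complex_of_real (quad l (t N) u) = of_real (r * r) * of_real (quad l (t N / r) (u / r))"
          unfolding q of_real_mult[symmetric] using r(1) by simp
        ultimately show ?thesis by (simp add: algebra_simps)
      qed
      then have "norm (of_nat N * (char_fun l (t N / r) (u / r) - 1) - complex_of_real (- quad l (t N) u / 2)) =
        r * r * norm (char_fun l (t N / r) (u / r) - of_real (1 - quad l (t N / r) (u / r) / 2))"
        using r(1) by (simp only: norm_mult norm_of_real) simp
      also have "\<dots> \<le> r * r * ((\<bar>t N / r\<bar> + \<bar>u / r\<bar>) ^ 3 * moment_bound)"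
        using r(1) by (intro mult_left_mono char_fun_taylor) simp
      also have "\<bar>t N / r\<bar> + \<bar>u / r\<bar> = (\<bar>t N\<bar> + \<bar>u\<bar>) / r"
        using r(1) by (simp add: add_divide_distrib)
      also have "r * r * (((\<bar>t N\<bar> + \<bar>u\<bar>) / r) ^ 3 * moment_bound) = (\<bar>t N\<bar> + \<bar>u\<bar>) ^ 3 * (moment_bound / r)"
        using r(1) by (simp add: field_simps eval_nat_numeral)
      finally show "norm (of_nat N * (char_fun l (t N / sqrt N) (u / sqrt N) - 1) -
        complex_of_real (- quad l (t N) u / 2)) \<le> (\<bar>t N\<bar> + \<bar>u\<bar>) ^ 3 * (moment_bound / sqrt N)"
        by (simp only: r_def)
    qed
    ultimately show "(\<lambda>N. of_nat N * (char_fun l (t N / sqrt N) (u / sqrt N) - 1) -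
        complex_of_real (- quad l (t N) u / 2)) \<longlonglongrightarrow> 0"
      by (rule Lim_null_comparison[rotated])
  qed
qed

lemma char_fun_0_tendsto_1: "(\<lambda>N. char_fun l 0 (u / sqrt (real N))) \<longlonglongrightarrow> 1"
proof (rule Lim_transform)
  have "(\<lambda>N. complex_of_real (1 - quad l 0 (u / sqrt N) / 2)) \<longlonglongrightarrow> of_real (1 - quad l 0 0 / 2)"
    unfolding quad_def by (intro tendsto_intros inverse_sqrt_tendsto_0) simp
  then show "(\<lambda>N. complex_of_real (1 - quad l 0 (u / sqrt N) / 2)) \<longlonglongrightarrow> 1"
    by (simp add: quad_def)
  have "(\<lambda>N. (\<bar>0\<bar> + \<bar>u / sqrt (real N)\<bar>) ^ 3 * moment_bound) \<longlonglongrightarrow> (\<bar>0\<bar> + \<bar>0\<bar>) ^ 3 * moment_bound"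
    by (intro tendsto_intros inverse_sqrt_tendsto_0)
  then have lim: "(\<lambda>N. (\<bar>0\<bar> + \<bar>u / sqrt (real N)\<bar>) ^ 3 * moment_bound) \<longlonglongrightarrow> 0" by simp
  show "(\<lambda>N. char_fun l 0 (u / sqrt (real N)) - complex_of_real (1 - quad l 0 (u / sqrt N) / 2)) \<longlonglongrightarrow> 0"
    by (rule Lim_null_comparison[OF _ lim]) (rule always_eventually, rule allI, rule char_fun_taylor)
qed

text \<open>Finitely many factors that tend to \<open>1\<close> may be dropped.\<close>
lemma base_power_limit:
  "(\<lambda>N. char_fun l 0 (u / sqrt (real N)) ^ (N - m)) \<longlonglongrightarrow> of_real (exp (- u\<^sup>2))"
proof -
  let ?g = "\<lambda>N. char_fun l 0 (u / sqrt (real N))"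
  have "(\<lambda>N. ?g N ^ N) \<longlonglongrightarrow> of_real (exp (- u\<^sup>2))"
    using char_fun_power_limit[of "\<lambda>_. 0" 0 l u] by (simp add: quad_def)
  then have "(\<lambda>N. ?g N ^ N / ?g N ^ m) \<longlonglongrightarrow> of_real (exp (- u\<^sup>2)) / 1 ^ m"
    by (intro tendsto_intros char_fun_0_tendsto_1) auto
  moreover have "\<forall>\<^sub>F N in sequentially. ?g N ^ N / ?g N ^ m = ?g N ^ (N - m)"
    using tendsto_imp_eventually_ne[OF char_fun_0_tendsto_1[of l u] zero_neq_one[symmetric]]
      eventually_ge_at_top[of m]
    by eventually_elim (simp add: power_diff)
  ultimately show ?thesis using Lim_transform_eventually by fastforce
qed

text \<open>Since \<open>u / sqrt N\<close> lies in \<open>[-pi, pi]\<close>, dropping \<open>m\<close> factors costs at most a constant.\<close>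
lemma char_fun_power_bound:
  assumes u: "\<bar>u\<bar> \<le> pi * sqrt (real N)"
  shows "norm (char_fun l s (u / sqrt N) ^ (N - m)) \<le>
    exp (decay (Suc l) * m * pi\<^sup>2) * exp (- decay (Suc l) * u\<^sup>2)"
proof -
  define \<theta> where "\<theta> = u / sqrt N"
  have \<theta>: "\<bar>\<theta>\<bar> \<le> pi"
    using u by (cases "N = 0") (auto simp: \<theta>_def divide_le_eq)
  have \<theta>N: "\<theta>\<^sup>2 * N = u\<^sup>2" using u by (cases "N = 0") (auto simp: \<theta>_def power_divide)
  have \<theta>2: "\<theta>\<^sup>2 \<le> pi\<^sup>2" using power_mono[OF \<theta>, of 2] by simp
  have d: "decay (Suc l) \<ge> 0" using geom_pos by (simp add: decay_def less_imp_le)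
  have "norm (char_fun l s \<theta> ^ (N - m)) \<le> exp (- decay (Suc l) * \<theta>\<^sup>2) ^ (N - m)"
    unfolding norm_power by (intro power_mono char_fun_decay \<theta>) simp
  also have "\<dots> = exp (- (decay (Suc l) * (\<theta>\<^sup>2 * real (N - m))))"
    by (simp add: exp_of_nat_mult[symmetric] mult_ac)
  also have "\<dots> \<le> exp (decay (Suc l) * (m * pi\<^sup>2) - decay (Suc l) * u\<^sup>2)"
  proof -
    have "u\<^sup>2 - m * pi\<^sup>2 \<le> \<theta>\<^sup>2 * N - m * \<theta>\<^sup>2" using \<theta>N mult_left_mono[OF \<theta>2, of "real m"] by simp
    also have "\<dots> = \<theta>\<^sup>2 * (real N - real m)" by (simp add: algebra_simps)
    also have "\<dots> \<le> \<theta>\<^sup>2 * real (N - m)" by (intro mult_left_mono) auto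
    finally have "decay (Suc l) * (u\<^sup>2 - m * pi\<^sup>2) \<le> decay (Suc l) * (\<theta>\<^sup>2 * real (N - m))"
      using d by (rule mult_left_mono)
    then show ?thesis by (simp add: algebra_simps)
  qed
  finally show ?thesis by (simp add: \<theta>_def exp_diff exp_minus field_simps)
qed

text \<open>The integral of \<open>G\<close> over \<open>[-pi, pi]\<close> after the substitution \<open>\<theta> = u / sqrt N\<close>, up to the Jacobian.\<close>
definition scaled_integral :: "nat \<Rightarrow> (real \<Rightarrow> complex) \<Rightarrow> complex" where
  "scaled_integral N G =
    (\<integral>u. indicator {- (pi * sqrt N)..pi * sqrt N} u *\<^sub>R G (u / sqrt N) \<partial>lborel)"

lemma integral_eq_scaled_integral:
  assumes "N > 0"
  shows "(\<integral>\<theta>. indicator {-pi..pi} \<theta> *\<^sub>R G \<theta> \<partial>lborel) = of_real (1 / sqrt N) * scaled_integral N G"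
proof -
  have s: "sqrt N > 0" using assms by simp
  have "(\<integral>\<theta>. indicator {-pi..pi} \<theta> *\<^sub>R G \<theta> \<partial>lborel) =
    \<bar>1 / sqrt N\<bar> *\<^sub>R (\<integral>u. indicator {-pi..pi} (0 + 1 / sqrt N * u) *\<^sub>R G (0 + 1 / sqrt N * u) \<partial>lborel)"
    by (rule lborel_integral_real_affine) (use s in simp)
  also have "(\<lambda>u. indicator {-pi..pi} (0 + 1 / sqrt N * u) *\<^sub>R G (0 + 1 / sqrt N * u)) =
    (\<lambda>u. indicator {- (pi * sqrt N)..pi * sqrt N} u *\<^sub>R G (u / sqrt N))"
    using s by (auto simp: indicator_def fun_eq_iff field_simps)
  finally show ?thesis using s by (simp add: scaled_integral_def scaleR_conv_of_real)
qed

lemma gaussian_integrable: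
  assumes c: "c > 0"
  shows "integrable lborel (\<lambda>u::real. C * (1 + u\<^sup>2) * exp (- c * u\<^sup>2))"
proof -
  define \<sigma> where "\<sigma> = sqrt (1 / (2 * c))"
  have \<sigma>: "\<sigma> > 0" "2 * \<sigma>\<^sup>2 = 1 / c" using c by (auto simp: \<sigma>_def)
  have "exp (- c * u\<^sup>2) = sqrt (pi / c) * normal_density 0 \<sigma> u" for u
  proof -
    have "2 * pi * \<sigma>\<^sup>2 = pi / c" using \<sigma>(2) by (simp add: field_simps)
    moreover have "- (u - 0)\<^sup>2 / (2 * \<sigma>\<^sup>2) = - c * u\<^sup>2" unfolding \<sigma>(2) using c by simp
    ultimately show ?thesis using c by (simp add: normal_density_def)
  qed
  then have "(\<lambda>u. C * (1 + u\<^sup>2) * exp (- c * u\<^sup>2)) =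
    (\<lambda>u. C * sqrt (pi / c) * (normal_density 0 \<sigma> u + normal_density 0 \<sigma> u * (u - 0) ^ 2))"
    by (simp add: fun_eq_iff algebra_simps)
  then show ?thesis
    using integrable_normal_moment[OF \<sigma>(1), of 0 2] \<sigma>(1)
    by (simp only:) (intro integrable_mult_right integrable_add, auto)
qed

lemma scaled_integral_limit:
  assumes meas: "\<And>N. G N \<in> borel_measurable borel"
    and c: "c > 0"
    and bound: "\<And>N u. \<bar>u\<bar> \<le> pi * sqrt (real N) \<Longrightarrow> norm (G N (u / sqrt (real N))) \<le> C * (1 + u\<^sup>2) * exp (- c * u\<^sup>2)"
    and lim: "\<And>u. (\<lambda>N. G N (u / sqrt (real N))) \<longlonglongrightarrow> H u"
  shows "(\<lambda>N. scaled_integral N (G N)) \<longlonglongrightarrow> (\<integral>u. H u \<partial>lborel)"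
  unfolding scaled_integral_def
proof (rule integral_dominated_convergence[OF _ _ gaussian_integrable[OF c, of C]])
  note meas[measurable]
  show *: "(\<lambda>u. indicator {- (pi * sqrt N)..pi * sqrt N} u *\<^sub>R G N (u / sqrt N)) \<in> borel_measurable lborel" for N
    by measurable
  have "(\<lambda>u. G N (u / sqrt (real N))) \<in> borel_measurable borel" for N by measurable
  then show "H \<in> borel_measurable lborel"
    using borel_measurable_LIMSEQ_metric[of "\<lambda>N u. G N (u / sqrt (real N))" borel H] lim by simp
  show "AE u in lborel. (\<lambda>N. indicator {- (pi * sqrt N)..pi * sqrt N} u *\<^sub>R G N (u / sqrt N)) \<longlonglongrightarrow> H u"
  proof (rule AE_I2)
    fix u :: real
    have "\<forall>\<^sub>F N in sequentially. \<bar>u\<bar> \<le> pi * sqrt (real N)"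
      by real_asymp
    then have "\<forall>\<^sub>F N in sequentially. G N (u / sqrt N) = indicator {- (pi * sqrt N)..pi * sqrt N} u *\<^sub>R G N (u / sqrt N)"
      by eventually_elim (auto simp: indicator_def abs_le_iff)
    then show "(\<lambda>N. indicator {- (pi * sqrt N)..pi * sqrt N} u *\<^sub>R G N (u / sqrt N)) \<longlonglongrightarrow> H u"
      by (rule Lim_transform_eventually[OF lim])
  qed
  show "AE u in lborel. norm (indicator {- (pi * sqrt N)..pi * sqrt N} u *\<^sub>R G N (u / sqrt N)) \<le>
    C * (1 + u\<^sup>2) * exp (- c * u\<^sup>2)" for N
  proof (rule AE_I2)
    fix u :: real
    have "0 \<le> C" using order_trans[OF norm_ge_zero bound[of 0 0]] by simp
    then have "0 \<le> C * (1 + u\<^sup>2) * exp (- c * u\<^sup>2)" by simp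
    then show "norm (indicator {- (pi * sqrt N)..pi * sqrt N} u *\<^sub>R G N (u / sqrt N)) \<le>
      C * (1 + u\<^sup>2) * exp (- c * u\<^sup>2)"
      using bound[of u N] by (auto simp: indicator_def abs_le_iff)
  qed
qed

lemma decay_pos: "decay m > 0"
  using geom_pos by (simp add: decay_def)

lemma measurable_char_fun [measurable]: "char_fun l s \<in> borel_measurable borel"
  unfolding char_fun_def by (rule measurable_transform)

lemma measurable_centered_transform [measurable]: "centered_transform m l \<in> borel_measurable borel"
  unfolding centered_transform_def by (rule measurable_transform)

lemma cis_tendsto_1: "(\<lambda>N. cis (u / sqrt (real N))) \<longlonglongrightarrow> 1"
proof -
  have "isCont cis 0" using continuous_on_cis[of UNIV "\<lambda>x. x"] continuous_on_eq_continuous_at[of UNIV cis] by auto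
  from isCont_tendsto_compose[OF this inverse_sqrt_tendsto_0[of u]] show ?thesis by simp
qed

text \<open>The asymptotic variance: the residual variance of the indicator after linear regression on the
  letter, whose variance is \<open>2\<close>.\<close>
definition limit_var :: "nat \<Rightarrow> real" where
  "limit_var l = block_var l - (block_cov l)\<^sup>2 / 2"

lemma normal_density_half: "normal_density \<mu> (sqrt (1/2)) u = exp (- (u - \<mu>)\<^sup>2) / sqrt pi"
  by (simp add: normal_density_def)

text \<open>Completing the square in \<open>quad l t u / 2\<close> with respect to \<open>u\<close> leaves \<open>limit_var l * t\<^sup>2 / 2\<close>.\<close>
lemma scaled_integral_char_fun_limit:
  assumes t: "t \<longlonglongrightarrow> t0"
  shows "(\<lambda>N. scaled_integral N (\<lambda>\<theta>. cis \<theta> * char_fun l (t N / sqrt N) \<theta> ^ N)) \<longlonglongrightarrow>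
    of_real (sqrt pi * exp (- limit_var l * t0\<^sup>2 / 2))"
proof -
  let ?c = "decay (Suc l)"
  have "(\<lambda>N. scaled_integral N (\<lambda>\<theta>. cis \<theta> * char_fun l (t N / sqrt N) \<theta> ^ N)) \<longlonglongrightarrow>
    (\<integral>u. of_real (exp (- quad l t0 u / 2)) \<partial>lborel)"
  proof (rule scaled_integral_limit[where c = ?c and C = 1])
    show "(\<lambda>\<theta>. cis \<theta> * char_fun l (t N / sqrt N) \<theta> ^ N) \<in> borel_measurable borel" for N
      by measurable
    fix N :: nat and u :: real assume u: "\<bar>u\<bar> \<le> pi * sqrt N"
    have "norm (char_fun l (t N / sqrt N) (u / sqrt N) ^ N) \<le> exp (- ?c * u\<^sup>2)"
      using char_fun_power_bound[OF u, of l _ 0] by simp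
    also have "\<dots> \<le> (1 + u\<^sup>2) * exp (- ?c * u\<^sup>2)" by (simp add: mult_le_cancel_right1)
    finally show "norm (cis (u / sqrt N) * char_fun l (t N / sqrt N) (u / sqrt N) ^ N) \<le>
      1 * (1 + u\<^sup>2) * exp (- ?c * u\<^sup>2)" by (simp add: norm_mult)
  next
    fix u
    have "(\<lambda>N. cis (u / sqrt N) * char_fun l (t N / sqrt N) (u / sqrt N) ^ N) \<longlonglongrightarrow>
      1 * of_real (exp (- quad l t0 u / 2))"
      by (intro tendsto_mult cis_tendsto_1 char_fun_power_limit t)
    then show "(\<lambda>N. cis (u / sqrt N) * char_fun l (t N / sqrt N) (u / sqrt N) ^ N) \<longlonglongrightarrow>
      of_real (exp (- quad l t0 u / 2))" by simp
  qed (rule decay_pos)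
  also have "(\<lambda>u. exp (- quad l t0 u / 2)) = (\<lambda>u. sqrt pi * exp (- limit_var l * t0\<^sup>2 / 2) *
    normal_density (- t0 * block_cov l / 2) (sqrt (1/2)) u)"
  proof
    fix u
    have "- quad l t0 u / 2 = - limit_var l * t0\<^sup>2 / 2 + - (u - - t0 * block_cov l / 2)\<^sup>2"
      by (simp add: quad_def limit_var_def power2_eq_square field_simps)
    then show "exp (- quad l t0 u / 2) = sqrt pi * exp (- limit_var l * t0\<^sup>2 / 2) *
      normal_density (- t0 * block_cov l / 2) (sqrt (1/2)) u"
      unfolding normal_density_half by (simp only: exp_add) simp
  qed
  then have "(\<integral>u. complex_of_real (exp (- quad l t0 u / 2)) \<partial>lborel) =
    of_real (sqrt pi * exp (- limit_var l * t0\<^sup>2 / 2))"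
    unfolding integral_complex_of_real by simp
  finally show ?thesis .
qed

text \<open>The zeroth-order term vanishes because the indicator is centred, so the transform is of order
  \<open>1 / sqrt N\<close> and its leading coefficient is the covariance.\<close>
lemma scaled_centered_transform_limit:
  "(\<lambda>N. of_real (sqrt N) * centered_transform 1 l (u / sqrt N)) \<longlonglongrightarrow> \<i> * of_real (u * block_cov l)"
proof (rule Lim_transform)
  show "(\<lambda>N. \<i> * complex_of_real (u * block_cov l)) \<longlonglongrightarrow> \<i> * of_real (u * block_cov l)" by simp
  have lim: "(\<lambda>N. (u\<^sup>2 * moment_bound) / sqrt (real N)) \<longlonglongrightarrow> 0" by (rule inverse_sqrt_tendsto_0)
  show "(\<lambda>N. of_real (sqrt N) * centered_transform 1 l (u / sqrt N) - \<i> * of_real (u * block_cov l)) \<longlonglongrightarrow> 0"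
  proof (rule Lim_null_comparison[OF _ lim], rule eventually_sequentiallyI)
    fix N assume N: "(1::nat) \<le> N"
    define r where "r = sqrt N"
    have r: "r > 0" using N by (auto simp: r_def)
    have "of_real r * centered_transform 1 l (u / r) - \<i> * of_real (u * block_cov l) =
      of_real r * (centered_transform 1 l (u / r) - \<i> * of_real (u / r * block_cov l))"
      using r by (simp add: field_simps)
    then have "norm (of_real r * centered_transform 1 l (u / r) - \<i> * of_real (u * block_cov l)) =
      r * norm (centered_transform 1 l (u / r) - \<i> * of_real (u / r * block_cov l))"
      using r by (simp add: norm_mult)
    also have "\<dots> \<le> r * ((u / r)\<^sup>2 * moment_bound)"
      using r by (intro mult_left_mono centered_transform_1_taylor) simp
    also have "\<dots> = (u\<^sup>2 * moment_bound) / r" using r by (simp add: field_simps power2_eq_square)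
    finally show "norm (of_real (sqrt N) * centered_transform 1 l (u / sqrt N) - \<i> * of_real (u * block_cov l)) \<le>
      (u\<^sup>2 * moment_bound) / sqrt N" by (simp only: r_def)
  qed
qed

lemma scaled_centered_transform_bound:
  "norm (of_real (sqrt N) * centered_transform 1 l (u / sqrt N)) \<le> \<bar>u\<bar> * moment_bound"
proof (cases "N = 0")
  case True
  then show ?thesis using moment_bound_nonneg by simp
next
  case False
  have "norm (of_real (sqrt N) * centered_transform 1 l (u / sqrt N)) \<le> \<bar>sqrt N\<bar> * (\<bar>u / sqrt N\<bar> * moment_bound)"
    unfolding norm_mult norm_of_real by (intro mult_left_mono centered_transform_1_bound) simp
  then show ?thesis using False by simp
qed

text \<open>The limiting integrand is odd.\<close>
lemma scaled_integral_mean_limit: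
  "(\<lambda>N. scaled_integral N (\<lambda>\<theta>. cis \<theta> * (of_real (sqrt N) * centered_transform 1 l \<theta> * char_fun l 0 \<theta> ^ (N - 1))))
    \<longlonglongrightarrow> 0"
proof -
  let ?c = "decay (Suc l)"
  define C where "C = moment_bound * exp (?c * 1 * pi\<^sup>2)"
  have "(\<lambda>N. scaled_integral N (\<lambda>\<theta>. cis \<theta> * (of_real (sqrt N) * centered_transform 1 l \<theta> * char_fun l 0 \<theta> ^ (N - 1))))
    \<longlonglongrightarrow> (\<integral>u. \<i> * of_real (u * block_cov l) * of_real (exp (- u\<^sup>2)) \<partial>lborel)"
  proof (rule scaled_integral_limit[where c = ?c and C = C])
    show "(\<lambda>\<theta>. cis \<theta> * (of_real (sqrt N) * centered_transform 1 l \<theta> * char_fun l 0 \<theta> ^ (N - 1))) \<in> borel_measurable borel" for N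
      by measurable
    fix N :: nat and u :: real assume u: "\<bar>u\<bar> \<le> pi * sqrt N"
    have u2: "\<bar>u\<bar> \<le> 1 + u\<^sup>2"
      using zero_le_power2[of "\<bar>u\<bar> - 1"] zero_le_power2[of u] by (simp add: power2_diff del: zero_le_power2)
    have "norm (of_real (sqrt N) * centered_transform 1 l (u / sqrt N)) * norm (char_fun l 0 (u / sqrt N) ^ (N - 1)) \<le>
      ((1 + u\<^sup>2) * moment_bound) * (exp (?c * real 1 * pi\<^sup>2) * exp (- ?c * u\<^sup>2))"
      using u2 moment_bound_nonneg
      by (intro mult_mono char_fun_power_bound[OF u] order_trans[OF scaled_centered_transform_bound] mult_right_mono) auto
    then show "norm (cis (u / sqrt N) * (of_real (sqrt N) * centered_transform 1 l (u / sqrt N) * char_fun l 0 (u / sqrt N) ^ (N - 1))) \<le>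
      C * (1 + u\<^sup>2) * exp (- ?c * u\<^sup>2)" by (simp add: norm_mult C_def mult_ac)
  next
    fix u
    have "(\<lambda>N. cis (u / sqrt N) * (of_real (sqrt N) * centered_transform 1 l (u / sqrt N) * char_fun l 0 (u / sqrt N) ^ (N - 1)))
      \<longlonglongrightarrow> 1 * (\<i> * of_real (u * block_cov l) * of_real (exp (- u\<^sup>2)))"
      by (intro tendsto_mult[OF cis_tendsto_1] tendsto_mult[OF scaled_centered_transform_limit] base_power_limit)
    then show "(\<lambda>N. cis (u / sqrt N) * (of_real (sqrt N) * centered_transform 1 l (u / sqrt N) * char_fun l 0 (u / sqrt N) ^ (N - 1)))
      \<longlonglongrightarrow> \<i> * of_real (u * block_cov l) * of_real (exp (- u\<^sup>2))" by simp
  qed (rule decay_pos)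
  also have "(\<lambda>u. \<i> * complex_of_real (u * block_cov l) * complex_of_real (exp (- u\<^sup>2))) =
    (\<lambda>u. \<i> * complex_of_real (block_cov l * sqrt pi * (normal_density 0 (sqrt (1/2)) u * (u - 0) ^ (2 * 0 + 1))))"
    unfolding normal_density_half by (simp add: fun_eq_iff)
  also have "(\<integral>u. \<dots> u \<partial>lborel) = 0"
  proof -
    have "(\<integral>u. block_cov l * sqrt pi * (normal_density 0 (sqrt (1/2)) u * (u - 0) ^ (2 * 0 + 1)) \<partial>lborel) = 0"
      using integral_normal_moment_odd[of "sqrt (1/2)" 0 0] by simp
    then show ?thesis
      by (subst Bochner_Integration.integral_mult_right_zero) (simp only: integral_complex_of_real of_real_0 mult_zero_right)
  qed
  finally show ?thesis .
qed

text \<open>The two summands come from equal and from distinct pairs of positions. There are about \<open>N\<^sup>2\<close>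
  of the latter; after division by \<open>N\<close> their contribution tends to \<open>- (u * block_cov l)\<^sup>2\<close>, whose
  integral against the Gaussian is the reduction of the variance.\<close>
lemma scaled_integral_second_moment_limit:
  "(\<lambda>N. scaled_integral N (\<lambda>\<theta>. cis \<theta> * (centered_transform 2 l \<theta> * char_fun l 0 \<theta> ^ (N - 1) +
      of_real (real N - 1) * (centered_transform 1 l \<theta>)\<^sup>2 * char_fun l 0 \<theta> ^ (N - 2))))
    \<longlonglongrightarrow> of_real (sqrt pi * limit_var l)"
proof -
  let ?c = "decay (Suc l)"
  define C where "C = (1 + moment_bound\<^sup>2) * exp (?c * 2 * pi\<^sup>2)"
  have "(\<lambda>N. scaled_integral N (\<lambda>\<theta>. cis \<theta> * (centered_transform 2 l \<theta> * char_fun l 0 \<theta> ^ (N - 1) +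
      of_real (real N - 1) * (centered_transform 1 l \<theta>)\<^sup>2 * char_fun l 0 \<theta> ^ (N - 2))))
    \<longlonglongrightarrow> (\<integral>u. of_real (block_var l) * of_real (exp (- u\<^sup>2)) +
      1 * (\<i> * of_real (u * block_cov l))\<^sup>2 * of_real (exp (- u\<^sup>2)) \<partial>lborel)"
  proof (rule scaled_integral_limit[where c = ?c and C = C])
    show "(\<lambda>\<theta>. cis \<theta> * (centered_transform 2 l \<theta> * char_fun l 0 \<theta> ^ (N - 1) +
      of_real (real N - 1) * (centered_transform 1 l \<theta>)\<^sup>2 * char_fun l 0 \<theta> ^ (N - 2))) \<in> borel_measurable borel" for N
      by measurable
    fix N :: nat and u :: real assume u: "\<bar>u\<bar> \<le> pi * sqrt N"
    let ?E = "exp (?c * 2 * pi\<^sup>2) * exp (- ?c * u\<^sup>2)"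
    have 1: "norm (char_fun l 0 (u / sqrt N) ^ (N - 1)) \<le> ?E"
      using char_fun_power_bound[OF u, of l 0 1] decay_pos[of "Suc l"]
      by (elim order_trans, intro mult_right_mono) auto
    have 2: "norm (char_fun l 0 (u / sqrt N) ^ (N - 2)) \<le> ?E"
      using char_fun_power_bound[OF u, of l 0 2] by simp
    have 3: "norm (complex_of_real (real N - 1) * (centered_transform 1 l (u / sqrt N))\<^sup>2) \<le> u\<^sup>2 * moment_bound\<^sup>2"
    proof (cases "N = 0")
      case True
      then show ?thesis using u centered_transform_1_bound[of l 0] by simp
    next
      case False
      have "norm (complex_of_real (real N - 1) * (centered_transform 1 l (u / sqrt N))\<^sup>2) \<le>
        real N * (norm (centered_transform 1 l (u / sqrt N)))\<^sup>2"
        unfolding norm_mult norm_of_real norm_power using False by (intro mult_right_mono) auto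
      also have "\<dots> = (norm (of_real (sqrt N) * centered_transform 1 l (u / sqrt N)))\<^sup>2"
        by (simp add: norm_mult power_mult_distrib)
      also have "\<dots> \<le> (\<bar>u\<bar> * moment_bound)\<^sup>2"
        by (intro power_mono scaled_centered_transform_bound) simp
      finally show ?thesis by (simp add: power_mult_distrib)
    qed
    have "norm (centered_transform 2 l (u / sqrt N) * char_fun l 0 (u / sqrt N) ^ (N - 1) +
      of_real (real N - 1) * (centered_transform 1 l (u / sqrt N))\<^sup>2 * char_fun l 0 (u / sqrt N) ^ (N - 2)) \<le>
      1 * ?E + (u\<^sup>2 * moment_bound\<^sup>2) * ?E"
      using 1 2 3 centered_transform_2_bound
      by (intro norm_triangle_le add_mono) (auto simp only: norm_mult[of "centered_transform 2 l _"] norm_mult[of "_ * _" "_ ^ _"] intro!: mult_mono norm_ge_zero mult_nonneg_nonneg zero_le_power2)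
    also have "\<dots> = (1 + u\<^sup>2 * moment_bound\<^sup>2) * ?E" by (simp add: algebra_simps)
    also have "\<dots> \<le> ((1 + moment_bound\<^sup>2) * (1 + u\<^sup>2)) * ?E"
      by (intro mult_right_mono) (auto simp: algebra_simps)
    finally show "norm (cis (u / sqrt N) * (centered_transform 2 l (u / sqrt N) * char_fun l 0 (u / sqrt N) ^ (N - 1) +
      of_real (real N - 1) * (centered_transform 1 l (u / sqrt N))\<^sup>2 * char_fun l 0 (u / sqrt N) ^ (N - 2))) \<le>
      C * (1 + u\<^sup>2) * exp (- ?c * u\<^sup>2)" by (simp only: norm_mult[of "cis _"] norm_cis C_def mult_ac mult_1_left)
  next
    fix u
    have "(\<lambda>N. centered_transform 2 l (u / sqrt (real N))) \<longlonglongrightarrow> of_real (block_var l)"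
    proof (rule Lim_transform[OF tendsto_const])
      have "(\<lambda>N. \<bar>u / sqrt (real N)\<bar> * moment_bound) \<longlonglongrightarrow> \<bar>0\<bar> * moment_bound"
        by (intro tendsto_intros inverse_sqrt_tendsto_0)
      then have lim: "(\<lambda>N. \<bar>u / sqrt (real N)\<bar> * moment_bound) \<longlonglongrightarrow> 0" by simp
      show "(\<lambda>N. centered_transform 2 l (u / sqrt (real N)) - of_real (block_var l)) \<longlonglongrightarrow> 0"
        by (rule Lim_null_comparison[OF _ lim], rule always_eventually, rule allI, rule centered_transform_2_taylor)
    qed
    moreover have "(\<lambda>N. of_real (real N - 1) * (centered_transform 1 l (u / sqrt N))\<^sup>2) \<longlonglongrightarrow>
      1 * (\<i> * of_real (u * block_cov l))\<^sup>2"
    proof (rule Lim_transform_eventually)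
      have "(\<lambda>N. (real N - 1) / real N) \<longlonglongrightarrow> 1" by real_asymp
      then have "(\<lambda>N. complex_of_real ((real N - 1) / real N)) \<longlonglongrightarrow> of_real 1" by (rule tendsto_of_real)
      then show "(\<lambda>N. of_real ((real N - 1) / real N) * (of_real (sqrt N) * centered_transform 1 l (u / sqrt N))\<^sup>2)
        \<longlonglongrightarrow> 1 * (\<i> * of_real (u * block_cov l))\<^sup>2"
        by (intro tendsto_mult tendsto_power scaled_centered_transform_limit) simp
      show "\<forall>\<^sub>F N in sequentially. of_real ((real N - 1) / real N) * (of_real (sqrt N) * centered_transform 1 l (u / sqrt N))\<^sup>2 =
        of_real (real N - 1) * (centered_transform 1 l (u / sqrt N))\<^sup>2"
        using eventually_gt_at_top[of 0]
      proof eventually_elim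
        case (elim N)
        have "(complex_of_real (sqrt N))\<^sup>2 = of_nat N" by (simp flip: of_real_power)
        then show ?case using elim by (simp add: power_mult_distrib)
      qed
    qed
    ultimately have "(\<lambda>N. cis (u / sqrt N) * (centered_transform 2 l (u / sqrt N) * char_fun l 0 (u / sqrt N) ^ (N - 1) +
      of_real (real N - 1) * (centered_transform 1 l (u / sqrt N))\<^sup>2 * char_fun l 0 (u / sqrt N) ^ (N - 2)))
      \<longlonglongrightarrow> 1 * (of_real (block_var l) * of_real (exp (- u\<^sup>2)) +
      1 * (\<i> * of_real (u * block_cov l))\<^sup>2 * of_real (exp (- u\<^sup>2)))"
      by (intro tendsto_mult[OF cis_tendsto_1] tendsto_add tendsto_mult[OF _ base_power_limit])
    then show "(\<lambda>N. cis (u / sqrt N) * (centered_transform 2 l (u / sqrt N) * char_fun l 0 (u / sqrt N) ^ (N - 1) +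
      of_real (real N - 1) * (centered_transform 1 l (u / sqrt N))\<^sup>2 * char_fun l 0 (u / sqrt N) ^ (N - 2)))
      \<longlonglongrightarrow> of_real (block_var l) * of_real (exp (- u\<^sup>2)) +
      1 * (\<i> * of_real (u * block_cov l))\<^sup>2 * of_real (exp (- u\<^sup>2))" by (simp only: mult_1_left)
  qed (rule decay_pos)
  also have "(\<lambda>u. complex_of_real (block_var l) * of_real (exp (- u\<^sup>2)) +
      1 * (\<i> * of_real (u * block_cov l))\<^sup>2 * of_real (exp (- u\<^sup>2))) =
    (\<lambda>u. complex_of_real (sqrt pi * (block_var l * normal_density 0 (sqrt (1/2)) u -
      (block_cov l)\<^sup>2 * (normal_density 0 (sqrt (1/2)) u * (u - 0) ^ (2 * 1)))))"
    unfolding normal_density_half by (simp add: fun_eq_iff power_mult_distrib power2_eq_square algebra_simps)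
  also have "(\<integral>u. \<dots> u \<partial>lborel) = of_real (sqrt pi * limit_var l)"
  proof -
    have "(\<integral>u. block_var l * normal_density 0 (sqrt (1/2)) u -
      (block_cov l)\<^sup>2 * (normal_density 0 (sqrt (1/2)) u * (u - 0) ^ (2 * 1)) \<partial>lborel) =
      block_var l * 1 - (block_cov l)\<^sup>2 * (1/2)"
      using normal_moment_even[of "sqrt (1/2)" 0 1]
      by (subst Bochner_Integration.integral_diff)
        (auto simp: has_bochner_integral_iff simp del: power_mult)
    then show ?thesis unfolding integral_complex_of_real by (simp add: limit_var_def)
  qed
  finally show ?thesis .
qed

section \<open>Moments of the number of blocks and the limit theorem\<close>

text \<open>For \<open>l = k + 1\<close>, one minus the left-hand side is \<open>limit_var l / geom l\<close>.\<close>
lemma block_fraction_small: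
  "geom (Suc k) * (1 + real k ^ 2 / 2) < 1"
proof -
  have "k ^ 2 + 2 < 8 * 2 ^ k"
  proof (induction k)
    case (Suc k)
    have "k < 2 ^ k" by (rule less_exp)
    moreover have "Suc k ^ 2 + 2 = k ^ 2 + 2 + (2 * k + 1)" by (simp add: power2_eq_square)
    ultimately have "Suc k ^ 2 + 2 < 8 * 2 ^ k + 8 * 2 ^ k" using Suc by linarith
    then show ?case by simp
  qed simp
  then have "real (k ^ 2 + 2) < real (8 * 2 ^ k)" by (subst of_nat_less_iff)
  then show ?thesis by (simp add: geom_def power_divide field_simps)
qed

lemma limit_var_pos:
  assumes "l \<ge> 1"
  shows "limit_var l > 0"
proof -
  obtain k where k: "l = Suc k" using assms by (cases l) auto
  have "limit_var l = geom l * (1 - geom (Suc k) * (1 + real k ^ 2 / 2))"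
    by (simp add: limit_var_def block_var_def block_cov_def k power2_eq_square algebra_simps)
  then show ?thesis using block_fraction_small[of k] geom_pos[of l] by simp
qed

text \<open>The common weight of all compositions and the Jacobian form the prefactor, which depends only on
  \<open>n\<close> and cancels in all expectations.\<close>
lemma sum_weak_compositions_scaled:
  fixes f :: "nat \<Rightarrow> nat \<Rightarrow> complex"
  assumes N: "N = Suc n" and bound: "\<And>j k. norm (f j k) \<le> 1"
  shows "(\<Sum>c\<in>weak_compositions N n. \<Prod>j<N. f j (c j)) =
    of_real (2 ^ (n + N) / (2 * pi * sqrt N)) * scaled_integral N (\<lambda>\<theta>. cis \<theta> * (\<Prod>j<N. transform (f j) \<theta>))"
proof -
  have N0: "N > 0" using N by simp
  have "(\<Prod>j<N. of_real (geom (c j)) * f j (c j)) = of_real ((1/2) ^ (n + N)) * (\<Prod>j<N. f j (c j))"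
    if "c \<in> weak_compositions N n" for c
  proof -
    have "(\<Prod>j<N. geom (c j)) = (1/2) ^ (\<Sum>j<N. Suc (c j))"
      unfolding geom_def by (rule power_sum[symmetric])
    also have "(\<Sum>j<N. Suc (c j)) = n + N"
      using that unfolding weak_compositions_def by (simp add: sum_Suc)
    finally show ?thesis by (simp add: prod.distrib flip: of_real_prod)
  qed
  then have "(\<Sum>c\<in>weak_compositions N n. \<Prod>j<N. of_real (geom (c j)) * f j (c j)) =
    of_real ((1/2) ^ (n + N)) * (\<Sum>c\<in>weak_compositions N n. \<Prod>j<N. f j (c j))"
    unfolding sum_distrib_left by (intro sum.cong) auto
  then have "of_real ((1/2) ^ (n + N)) * (\<Sum>c\<in>weak_compositions N n. \<Prod>j<N. f j (c j)) =
    1 / (2 * pi) * (of_real (1 / sqrt N) * scaled_integral N (\<lambda>\<theta>. cis \<theta> * (\<Prod>j<N. transform (f j) \<theta>)))"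
    using sum_weak_compositions_Fourier[where f = f and B = 1, OF N bound]
    unfolding integral_eq_scaled_integral[OF N0] by (simp only:)
  then have "of_real (2 ^ (n + N)) * (of_real ((1/2) ^ (n + N)) * (\<Sum>c\<in>weak_compositions N n. \<Prod>j<N. f j (c j))) =
    of_real (2 ^ (n + N)) * (1 / (2 * pi) * (of_real (1 / sqrt N) * scaled_integral N (\<lambda>\<theta>. cis \<theta> * (\<Prod>j<N. transform (f j) \<theta>))))"
    by (rule arg_cong)
  moreover have "complex_of_real (2 ^ (n + N)) * of_real ((1/2) ^ (n + N)) = 1"
    by (simp add: power_mult_distrib[symmetric])
  ultimately show ?thesis by (simp add: mult.assoc[symmetric])
qed

text \<open>The deviation of the number of letters \<open>l\<close> from \<open>N * geom l\<close>.\<close>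
definition word_dev :: "nat \<Rightarrow> nat \<Rightarrow> (nat \<Rightarrow> nat) \<Rightarrow> real" where
  "word_dev l N c = (\<Sum>j<N. centered l (c j))"

lemma transform_1: "transform (\<lambda>_. 1) = char_fun l 0"
  by (simp add: char_fun_def)

lemma prod_if_one:
  fixes x y :: "'a::comm_monoid_mult"
  assumes "i < N"
  shows "(\<Prod>j<N. if j = i then x else y) = x * y ^ (N - 1)"
proof -
  have "(\<Prod>j<N. if j = i then x else y) = x * (\<Prod>j\<in>{..<N} - {i}. if j = i then x else y)"
    using assms by (subst prod.remove[of _ i]) auto
  also have "(\<Prod>j\<in>{..<N} - {i}. if j = i then x else y) = (\<Prod>j\<in>{..<N} - {i}. y)"
    by (rule prod.cong) auto
  finally show ?thesis using assms by simp
qed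

lemma prod_if_two:
  fixes x y :: "'a::comm_monoid_mult"
  assumes "i < N" "k < N" "i \<noteq> k"
  shows "(\<Prod>j<N. if j = i \<or> j = k then x else y) = x * x * y ^ (N - 2)"
proof -
  have "(\<Prod>j<N. if j = i \<or> j = k then x else y) =
    x * (x * (\<Prod>j\<in>{..<N} - {i} - {k}. if j = i \<or> j = k then x else y))"
    using assms by (subst prod.remove[of _ i], auto) (subst prod.remove[of _ k], auto)
  also have "(\<Prod>j\<in>{..<N} - {i} - {k}. if j = i \<or> j = k then x else y) = (\<Prod>j\<in>{..<N} - {i} - {k}. y)"
    by (rule prod.cong) auto
  also have "\<dots> = y ^ (N - 2)" using assms by (simp add: numeral_2_eq_2)
  finally show ?thesis by (simp add: mult.assoc)
qed

lemma scaled_integrable: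
  fixes G :: "real \<Rightarrow> complex"
  assumes [measurable]: "G \<in> borel_measurable borel" and "\<And>\<theta>. norm (G \<theta>) \<le> B"
  shows "integrable lborel (\<lambda>u. indicator {- (pi * sqrt N)..pi * sqrt N} u *\<^sub>R G (u / sqrt N))"
proof (rule integrableI_bounded_set_indicator[where B = B and f = "\<lambda>u. G (u / sqrt N)"])
  show "(\<lambda>u. G (u / sqrt N)) \<in> borel_measurable lborel" by measurable
qed (use assms(2) in \<open>auto simp: emeasure_lborel_Icc_eq\<close>)

lemma scaled_integral_mult: "scaled_integral N (\<lambda>\<theta>. a * G \<theta>) = a * scaled_integral N G"
proof -
  have "(\<lambda>u. indicator {- (pi * sqrt N)..pi * sqrt N} u *\<^sub>R (a * G (u / sqrt N))) =
    (\<lambda>u. a * (indicator {- (pi * sqrt N)..pi * sqrt N} u *\<^sub>R G (u / sqrt N)))" by simp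
  then show ?thesis
    unfolding scaled_integral_def by (simp only: Bochner_Integration.integral_mult_right_zero)
qed

lemma norm_centered_transform_le_1: "norm (centered_transform m l \<theta>) \<le> 1"
  unfolding centered_transform_def by (rule norm_transform_le) (rule power_centered_le_1)

lemma sum_words_one:
  assumes N: "N = Suc n"
  shows "(\<Sum>c\<in>weak_compositions N n. 1) = of_real (2 ^ (n + N) / (2 * pi * sqrt N)) *
    scaled_integral N (\<lambda>\<theta>. cis \<theta> * char_fun l 0 \<theta> ^ N)"
  using sum_weak_compositions_scaled[OF N, of "\<lambda>_ _. 1"] by (simp add: transform_1[of l])

lemma sum_words_cis:
  assumes N: "N = Suc n"
  shows "(\<Sum>c\<in>weak_compositions N n. cis (s * word_dev l N c)) = of_real (2 ^ (n + N) / (2 * pi * sqrt N)) *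
    scaled_integral N (\<lambda>\<theta>. cis \<theta> * char_fun l s \<theta> ^ N)"
proof -
  have "cis (s * word_dev l N c) = (\<Prod>j<N. cis (s * centered l (c j)))" for c
  proof -
    have "cis (sum g A) = (\<Prod>j\<in>A. cis (g j))" if "finite A" for g :: "nat \<Rightarrow> real" and A
      using that by (induction A rule: finite_induct) (auto simp: cis_mult[symmetric])
    then show ?thesis by (simp add: word_dev_def sum_distrib_left)
  qed
  then show ?thesis
    using sum_weak_compositions_scaled[OF N, of "\<lambda>_ k. cis (s * centered l k)"]
    by (simp add: char_fun_def)
qed

lemma sum_words_single:
  assumes N: "N = Suc n" and i: "i < N"
  shows "(\<Sum>c\<in>weak_compositions N n. of_real (centered l (c i) ^ m)) = of_real (2 ^ (n + N) / (2 * pi * sqrt N)) *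
    scaled_integral N (\<lambda>\<theta>. cis \<theta> * (centered_transform m l \<theta> * char_fun l 0 \<theta> ^ (N - 1)))"
proof -
  define f where "f j k = (if j = i then complex_of_real (centered l k ^ m) else 1)" for j k
  have "(\<Prod>j<N. f j (c j)) = of_real (centered l (c i) ^ m)" for c
    using i by (simp add: f_def prod.delta)
  moreover have "(\<Prod>j<N. transform (f j) \<theta>) = centered_transform m l \<theta> * char_fun l 0 \<theta> ^ (N - 1)" for \<theta>
  proof -
    have "transform (f j) \<theta> = (if j = i then centered_transform m l \<theta> else char_fun l 0 \<theta>)" for j
      by (simp add: f_def[abs_def] centered_transform_def transform_1[of l])
    then show ?thesis using prod_if_one[OF i] by simp
  qed
  moreover have "norm (f j k) \<le> 1" for j k using power_centered_le_1 by (simp add: f_def)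
  ultimately show ?thesis using sum_weak_compositions_scaled[OF N, of f] by simp
qed

lemma sum_words_pair:
  assumes N: "N = Suc n" and ik: "i < N" "k < N" "i \<noteq> k"
  shows "(\<Sum>c\<in>weak_compositions N n. of_real (centered l (c i) * centered l (c k))) =
    of_real (2 ^ (n + N) / (2 * pi * sqrt N)) *
    scaled_integral N (\<lambda>\<theta>. cis \<theta> * ((centered_transform 1 l \<theta>)\<^sup>2 * char_fun l 0 \<theta> ^ (N - 2)))"
proof -
  define f where "f j m = (if j = i \<or> j = k then complex_of_real (centered l m ^ 1) else 1)" for j m
  have "(\<Prod>j<N. f j (c j)) = of_real (centered l (c i) * centered l (c k))" for c
  proof -
    have "(\<Prod>j<N. f j (c j)) = f i (c i) * (f k (c k) * (\<Prod>j\<in>{..<N} - {i} - {k}. f j (c j)))"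
      using prod.remove[of "{..<N}" i "\<lambda>j. f j (c j)"] prod.remove[of "{..<N} - {i}" k "\<lambda>j. f j (c j)"] ik
      by (simp del: Diff_insert0)
    also have "(\<Prod>j\<in>{..<N} - {i} - {k}. f j (c j)) = 1" by (rule prod.neutral) (auto simp: f_def)
    finally show ?thesis by (simp add: f_def)
  qed
  moreover have "(\<Prod>j<N. transform (f j) \<theta>) = (centered_transform 1 l \<theta>)\<^sup>2 * char_fun l 0 \<theta> ^ (N - 2)" for \<theta>
  proof -
    have "transform (f j) \<theta> = (if j = i \<or> j = k then centered_transform 1 l \<theta> else char_fun l 0 \<theta>)" for j
      by (simp add: f_def[abs_def] centered_transform_def transform_1[of l])
    then show ?thesis using prod_if_two[OF ik, of "centered_transform 1 l \<theta>" "char_fun l 0 \<theta>"]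
      by (simp add: power2_eq_square)
  qed
  moreover have "norm (f j m) \<le> 1" for j m using power_centered_le_1[of l m 1] by (simp add: f_def)
  ultimately show ?thesis using sum_weak_compositions_scaled[OF N, of f] by simp
qed

lemma sum_words_first:
  assumes N: "N = Suc n"
  shows "(\<Sum>c\<in>weak_compositions N n. of_real (word_dev l N c / sqrt N)) = of_real (2 ^ (n + N) / (2 * pi * sqrt N)) *
    scaled_integral N (\<lambda>\<theta>. cis \<theta> * (of_real (sqrt N) * centered_transform 1 l \<theta> * char_fun l 0 \<theta> ^ (N - 1)))"
proof -
  let ?K = "complex_of_real (2 ^ (n + N) / (2 * pi * sqrt N))"
  let ?G = "\<lambda>\<theta>. cis \<theta> * (centered_transform 1 l \<theta> * char_fun l 0 \<theta> ^ (N - 1))"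
  have "(\<Sum>c\<in>weak_compositions N n. complex_of_real (word_dev l N c / sqrt N)) =
    (\<Sum>c\<in>weak_compositions N n. \<Sum>i<N. of_real (centered l (c i) ^ 1)) * of_real (1 / sqrt N)"
    by (simp add: word_dev_def sum_divide_distrib)
  also have "(\<Sum>c\<in>weak_compositions N n. \<Sum>i<N. complex_of_real (centered l (c i) ^ 1)) =
    (\<Sum>i<N. \<Sum>c\<in>weak_compositions N n. of_real (centered l (c i) ^ 1))"
    by (rule sum.swap)
  also have "\<dots> = (\<Sum>i<N. ?K * scaled_integral N ?G)"
    by (rule sum.cong) (simp_all only: sum_words_single[OF N] lessThan_iff)
  also have "\<dots> * of_real (1 / sqrt N) = ?K * (of_real (real N / sqrt N) * scaled_integral N ?G)"
    by simp
  also have "real N / sqrt N = sqrt N" by (simp add: real_div_sqrt)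
  also have "of_real (sqrt N) * scaled_integral N ?G = scaled_integral N (\<lambda>\<theta>. of_real (sqrt N) * ?G \<theta>)"
    by (rule scaled_integral_mult[symmetric])
  finally show ?thesis by (simp only: mult_ac)
qed

text \<open>The square of the sum is expanded into \<open>N\<close> diagonal and \<open>N * (N - 1)\<close> off-diagonal terms, each kind
  having a common Fourier integral.\<close>
lemma sum_words_second:
  assumes N: "N = Suc n"
  shows "(\<Sum>c\<in>weak_compositions N n. of_real ((word_dev l N c / sqrt N)\<^sup>2)) = of_real (2 ^ (n + N) / (2 * pi * sqrt N)) *
    scaled_integral N (\<lambda>\<theta>. cis \<theta> * (centered_transform 2 l \<theta> * char_fun l 0 \<theta> ^ (N - 1) +
      of_real (real N - 1) * (centered_transform 1 l \<theta>)\<^sup>2 * char_fun l 0 \<theta> ^ (N - 2)))"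
proof -
  let ?K = "complex_of_real (2 ^ (n + N) / (2 * pi * sqrt N))"
  let ?W = "weak_compositions N n"
  define G1 where "G1 \<theta> = cis \<theta> * (centered_transform 2 l \<theta> * char_fun l 0 \<theta> ^ (N - 1))" for \<theta>
  define G2 where "G2 \<theta> = cis \<theta> * ((centered_transform 1 l \<theta>)\<^sup>2 * char_fun l 0 \<theta> ^ (N - 2))" for \<theta>
  have "complex_of_real ((word_dev l N c / sqrt N)\<^sup>2) =
      (\<Sum>i<N. \<Sum>k<N. of_real (centered l (c i) * centered l (c k))) / of_nat N" for c
    by (simp add: word_dev_def power_divide power2_eq_square sum_product flip: of_real_mult)
  then have "(\<Sum>c\<in>?W. complex_of_real ((word_dev l N c / sqrt N)\<^sup>2)) =
    (\<Sum>c\<in>?W. \<Sum>i<N. \<Sum>k<N. of_real (centered l (c i) * centered l (c k))) / of_nat N"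
    by (simp add: sum_divide_distrib)
  also have "(\<Sum>c\<in>?W. \<Sum>i<N. \<Sum>k<N. complex_of_real (centered l (c i) * centered l (c k))) =
    (\<Sum>i<N. \<Sum>k<N. \<Sum>c\<in>?W. of_real (centered l (c i) * centered l (c k)))"
    by (subst sum.swap) (intro sum.cong refl sum.swap)
  also have "\<dots> = (\<Sum>i<N. ?K * scaled_integral N G1 + of_real (real N - 1) * (?K * scaled_integral N G2))"
  proof (rule sum.cong)
    fix i assume i: "i \<in> {..<N}"
    have "(\<Sum>c\<in>?W. complex_of_real (centered l (c i) * centered l (c i))) = ?K * scaled_integral N G1"
      using sum_words_single[OF N, of i l 2] i by (simp add: G1_def[abs_def] power2_eq_square)
    moreover have "(\<Sum>k\<in>{..<N} - {i}. \<Sum>c\<in>?W. complex_of_real (centered l (c i) * centered l (c k))) =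
      (\<Sum>k\<in>{..<N} - {i}. ?K * scaled_integral N G2)"
      unfolding G2_def using i by (intro sum.cong sum_words_pair[OF N]) auto
    moreover have "\<dots> = of_real (real N - 1) * (?K * scaled_integral N G2)"
      using i by (simp add: of_nat_diff)
    ultimately show "(\<Sum>k<N. \<Sum>c\<in>?W. complex_of_real (centered l (c i) * centered l (c k))) =
      ?K * scaled_integral N G1 + of_real (real N - 1) * (?K * scaled_integral N G2)"
      using i by (subst sum.remove[of _ i]) auto
  qed simp
  also have "\<dots> / of_nat N = ?K * (scaled_integral N G1 + of_real (real N - 1) * scaled_integral N G2)"
  proof -
    have "complex_of_nat N \<noteq> 0" using N by (simp del: of_nat_Suc)
    then have "(\<Sum>i<N. X) / of_nat N = X" for X :: complex by simp
    then show ?thesis by (simp only:) (simp only: distrib_left mult.left_commute)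
  qed
  also have "scaled_integral N G1 + of_real (real N - 1) * scaled_integral N G2 =
    scaled_integral N (\<lambda>\<theta>. G1 \<theta> + of_real (real N - 1) * G2 \<theta>)"
  proof -
    have [measurable]: "G1 \<in> borel_measurable borel" "G2 \<in> borel_measurable borel"
      unfolding G1_def[abs_def] G2_def[abs_def] by measurable
    have b: "norm (x * (y * z)) \<le> 1" if "norm x \<le> 1" "norm y \<le> 1" "norm z \<le> 1" for x y z :: complex
      using that by (simp add: norm_mult mult_le_one)
    have "norm (G1 \<theta>) \<le> 1" "norm (G2 \<theta>) \<le> 1" for \<theta>
      unfolding G1_def G2_def
      by (intro b, simp_all add: norm_power power_le_one norm_char_fun_le_1 norm_centered_transform_le_1)+
    then have "integrable lborel (\<lambda>u. indicator {- (pi * sqrt N)..pi * sqrt N} u *\<^sub>R G1 (u / sqrt N))"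
      "integrable lborel (\<lambda>u. of_real (real N - 1) * (indicator {- (pi * sqrt N)..pi * sqrt N} u *\<^sub>R G2 (u / sqrt N)))"
      by (intro integrable_mult_right scaled_integrable[where B = 1]; measurable)+
    from Bochner_Integration.integral_add[OF this] show ?thesis
      unfolding scaled_integral_def scaled_integral_mult[unfolded scaled_integral_def, symmetric]
      by (simp add: scaleR_add_right mult_scaleR_right)
  qed
  finally show ?thesis unfolding G1_def G2_def by (simp only: distrib_left mult_ac)
qed

lemma of_bool_sum_eq_word_dev:
  "(\<Sum>j<N. of_bool (c j = l)) - real N * geom l = word_dev l N c"
  by (simp add: word_dev_def centered_def sum_subtractf)

text \<open>The centring is by the approximate mean \<open>(n + 1) * geom l\<close>, which makes the Fourier integrals
  exact; the difference from the true mean is treated separately.\<close>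
definition block_dev :: "nat \<Rightarrow> nat \<Rightarrow> nat set set \<Rightarrow> real" where
  "block_dev l n P = (num_blocks l P - real (Suc n) * geom l) / sqrt (Suc n)"

lemma expectation_block_dev:
  fixes h :: "real \<Rightarrow> complex"
  assumes l: "l \<ge> 1" and N: "N = Suc n"
    and A: "(\<Sum>c\<in>weak_compositions N n. h (word_dev l N c / sqrt N)) =
      of_real (2 ^ (n + N) / (2 * pi * sqrt N)) * I"
  shows "measure_pmf.expectation (random_NC n) (\<lambda>P. h (block_dev l n P)) =
    I / scaled_integral N (\<lambda>\<theta>. cis \<theta> * char_fun l 0 \<theta> ^ N)"
proof -
  have "measure_pmf.expectation (random_NC n) (\<lambda>P. h (block_dev l n P)) =
    (\<Sum>c\<in>weak_compositions N n. h (((\<Sum>j<N. of_bool (c j = l)) - real N * geom l) / sqrt N)) /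
      (\<Sum>c\<in>weak_compositions N n. 1)"
    unfolding block_dev_def N by (rule expectation_random_NC[OF l])
  also have "\<dots> = (of_real (2 ^ (n + N) / (2 * pi * sqrt N)) * I) /
    (of_real (2 ^ (n + N) / (2 * pi * sqrt N)) * scaled_integral N (\<lambda>\<theta>. cis \<theta> * char_fun l 0 \<theta> ^ N))"
    unfolding of_bool_sum_eq_word_dev A sum_words_one[OF N, of l] ..
  also have "\<dots> = I / scaled_integral N (\<lambda>\<theta>. cis \<theta> * char_fun l 0 \<theta> ^ N)"
    using N by (intro mult_divide_mult_cancel_left) simp
  finally show ?thesis .
qed

lemma scaled_integral_denominator_limit:
  "(\<lambda>N. scaled_integral N (\<lambda>\<theta>. cis \<theta> * char_fun l 0 \<theta> ^ N)) \<longlonglongrightarrow> of_real (sqrt pi)"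
  using scaled_integral_char_fun_limit[of "\<lambda>_. 0" 0 l] by simp

text \<open>Letting the argument depend on \<open>n\<close> makes it possible to insert the true standard deviation.\<close>
lemma block_dev_char_limit:
  assumes l: "l \<ge> 1" and t: "t \<longlonglongrightarrow> t0"
  shows "(\<lambda>n. measure_pmf.expectation (random_NC n) (\<lambda>P. cis (t n * block_dev l n P)))
    \<longlonglongrightarrow> of_real (exp (- limit_var l * t0\<^sup>2 / 2))"
proof -
  \<comment> \<open>the Fourier integrals are indexed by \<open>N = n + 1\<close>\<close>
  define t' where "t' N = t (N - 1)" for N
  have t': "t' \<longlonglongrightarrow> t0"
    unfolding t'_def by (rule LIMSEQ_imp_Suc) (use t in simp)
  have "measure_pmf.expectation (random_NC n) (\<lambda>P. cis (t n * block_dev l n P)) =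
    scaled_integral (Suc n) (\<lambda>\<theta>. cis \<theta> * char_fun l (t' (Suc n) / sqrt (Suc n)) \<theta> ^ Suc n) /
    scaled_integral (Suc n) (\<lambda>\<theta>. cis \<theta> * char_fun l 0 \<theta> ^ Suc n)" for n
    using sum_words_cis[of "Suc n" n "t n / sqrt (Suc n)" l]
    by (intro expectation_block_dev[OF l refl]) (simp add: t'_def del: of_nat_Suc power_Suc)
  moreover have "(\<lambda>N. scaled_integral N (\<lambda>\<theta>. cis \<theta> * char_fun l (t' N / sqrt N) \<theta> ^ N) /
    scaled_integral N (\<lambda>\<theta>. cis \<theta> * char_fun l 0 \<theta> ^ N)) \<longlonglongrightarrow>
    of_real (sqrt pi * exp (- limit_var l * t0\<^sup>2 / 2)) / of_real (sqrt pi)"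
    by (intro tendsto_divide scaled_integral_char_fun_limit t' scaled_integral_denominator_limit) simp
  ultimately show ?thesis by (simp only:) (drule LIMSEQ_Suc, simp)
qed

lemma finite_set_random_NC: "finite (set_pmf (random_NC n))"
  unfolding random_NC_def by (simp add: set_pmf_of_set[OF NC_nonempty finite_NC] finite_NC)

lemma integrable_random_NC [simp]:
  "integrable (measure_pmf (random_NC n)) (f :: _ \<Rightarrow> 'b::{banach, second_countable_topology})"
  by (rule integrable_measure_pmf_finite[OF finite_set_random_NC])

lemma expectation_block_dev_limit:
  assumes l: "l \<ge> 1"
    and A: "\<And>n. (\<Sum>c\<in>weak_compositions (Suc n) n. complex_of_real (h (word_dev l (Suc n) c / sqrt (Suc n)))) =
      of_real (2 ^ (n + Suc n) / (2 * pi * sqrt (Suc n))) * I (Suc n)"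
    and I: "I \<longlonglongrightarrow> of_real (sqrt pi * a)"
  shows "(\<lambda>n. measure_pmf.expectation (random_NC n) (\<lambda>P. h (block_dev l n P))) \<longlonglongrightarrow> a"
proof -
  have "(\<lambda>N. I N / scaled_integral N (\<lambda>\<theta>. cis \<theta> * char_fun l 0 \<theta> ^ N)) \<longlonglongrightarrow> of_real (sqrt pi * a) / of_real (sqrt pi)"
    by (intro tendsto_divide I scaled_integral_denominator_limit) simp
  then have "(\<lambda>n. I (Suc n) / scaled_integral (Suc n) (\<lambda>\<theta>. cis \<theta> * char_fun l 0 \<theta> ^ Suc n)) \<longlonglongrightarrow> of_real a"
    by (drule_tac LIMSEQ_Suc) simp
  moreover have "I (Suc n) / scaled_integral (Suc n) (\<lambda>\<theta>. cis \<theta> * char_fun l 0 \<theta> ^ Suc n) =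
      complex_of_real (measure_pmf.expectation (random_NC n) (\<lambda>P. h (block_dev l n P)))" for n
    unfolding integral_complex_of_real[symmetric]
    by (rule expectation_block_dev[OF l refl A, symmetric])
  ultimately have "(\<lambda>n. complex_of_real (measure_pmf.expectation (random_NC n) (\<lambda>P. h (block_dev l n P)))) \<longlonglongrightarrow> of_real a"
    by simp
  then show ?thesis by (simp only: tendsto_of_real_iff)
qed

lemma block_dev_mean_limit:
  assumes "l \<ge> 1"
  shows "(\<lambda>n. measure_pmf.expectation (random_NC n) (block_dev l n)) \<longlonglongrightarrow> 0"
  using expectation_block_dev_limit[OF assms, of "\<lambda>x. x", OF sum_words_first[OF refl], of 0]
    scaled_integral_mean_limit[of l] by simp

lemma block_dev_second_moment_limit:
  assumes "l \<ge> 1"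
  shows "(\<lambda>n. measure_pmf.expectation (random_NC n) (\<lambda>P. (block_dev l n P)\<^sup>2)) \<longlonglongrightarrow> limit_var l"
  using expectation_block_dev_limit[OF assms, of "\<lambda>x. x\<^sup>2", OF sum_words_second[OF refl], of "limit_var l"]
    scaled_integral_second_moment_limit[of l] by simp

text \<open>Standardization is invariant under affine changes of the variable. If the variance vanishes, both
  sides are \<open>0\<close> because division by \<open>0\<close> gives \<open>0\<close>.\<close>
lemma standardized_num_blocks_eq:
  fixes l n
  defines "m \<equiv> measure_pmf.expectation (random_NC n) (block_dev l n)"
  defines "v \<equiv> measure_pmf.expectation (random_NC n) (\<lambda>P. (block_dev l n P)\<^sup>2) - m\<^sup>2"
  shows "standardized_num_blocks l n P = (block_dev l n P - m) / sqrt v"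
proof -
  let ?E = "measure_pmf.expectation (random_NC n)"
  define r where "r = sqrt (Suc n)"
  have r: "r > 0" by (simp add: r_def)
  have nb: "num_blocks l Q = real (Suc n) * geom l + r * block_dev l n Q" for Q
    using r by (simp add: block_dev_def r_def del: of_nat_Suc)
  have mean: "?E (num_blocks l) = real (Suc n) * geom l + r * m"
    unfolding nb m_def by simp
  have "measure_pmf.variance (random_NC n) (num_blocks l) = ?E (\<lambda>Q. r\<^sup>2 * (block_dev l n Q - m)\<^sup>2)"
    unfolding mean by (simp add: nb power_mult_distrib[symmetric] algebra_simps)
  also have "\<dots> = r\<^sup>2 * ?E (\<lambda>Q. (block_dev l n Q - m)\<^sup>2)" by simp
  also have "?E (\<lambda>Q. (block_dev l n Q - m)\<^sup>2) = v"
    using measure_pmf.variance_eq[of "random_NC n" "block_dev l n"] by (simp add: v_def m_def)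
  finally have "sqrt (measure_pmf.variance (random_NC n) (num_blocks l)) = r * sqrt v"
    using r by (simp add: real_sqrt_mult)
  moreover have "num_blocks l P - ?E (num_blocks l) = r * (block_dev l n P - m)"
    unfolding mean by (simp add: nb algebra_simps)
  ultimately show ?thesis unfolding standardized_num_blocks_def using r by simp
qed

theorem theorem2p5:
  fixes l :: nat and x :: real
  assumes "l \<ge> 1"
  shows "(\<lambda>n. cdf (distr (measure_pmf (random_NC n)) borel (standardized_num_blocks l n)) x)
           \<longlonglongrightarrow> cdf std_normal_distribution x"
proof -
  let ?M = "\<lambda>n. distr (measure_pmf (random_NC n)) borel (standardized_num_blocks l n)"
  define m where "m n = measure_pmf.expectation (random_NC n) (block_dev l n)" for n
  define v where "v n = measure_pmf.expectation (random_NC n) (\<lambda>P. (block_dev l n P)\<^sup>2) - (m n)\<^sup>2" for n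
  have m: "m \<longlonglongrightarrow> 0" unfolding m_def by (rule block_dev_mean_limit[OF assms])
  have "v \<longlonglongrightarrow> limit_var l - 0\<^sup>2"
    unfolding v_def by (intro tendsto_intros block_dev_second_moment_limit[OF assms] m)
  then have v: "v \<longlonglongrightarrow> limit_var l" by simp
  have pos: "sqrt (limit_var l) > 0" using limit_var_pos[OF assms] by simp
  have std: "standardized_num_blocks l n P = (block_dev l n P - m n) / sqrt (v n)" for n P
    unfolding m_def v_def by (rule standardized_num_blocks_eq)
  have "weak_conv_m ?M std_normal_distribution"
  proof (rule levy_continuity)
    show "real_distribution (?M n)" for n
      by (rule prob_space.real_distribution_distr) (auto intro: measure_pmf.prob_space_axioms)
    show "real_distribution std_normal_distribution" by (rule real_dist_normal_dist)
    fix t :: real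
    have "char (?M n) t = cis (- (t * m n / sqrt (v n))) *
        measure_pmf.expectation (random_NC n) (\<lambda>P. cis (t / sqrt (v n) * block_dev l n P))" for n
    proof -
      have "char (?M n) t = measure_pmf.expectation (random_NC n) (\<lambda>P. cis (t * standardized_num_blocks l n P))"
        unfolding char_def by (subst integral_distr) (auto simp: cis_conv_exp)
      also have "(\<lambda>P. cis (t * standardized_num_blocks l n P)) =
        (\<lambda>P. cis (- (t * m n / sqrt (v n))) * cis (t / sqrt (v n) * block_dev l n P))"
        unfolding std cis_mult by (intro ext arg_cong[where f = cis]) (simp add: diff_divide_distrib algebra_simps)
      finally show ?thesis by simp
    qed
    moreover have "(\<lambda>n. cis (- (t * m n / sqrt (v n))) *
        measure_pmf.expectation (random_NC n) (\<lambda>P. cis (t / sqrt (v n) * block_dev l n P))) \<longlonglongrightarrow>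
      cis (- (t * 0 / sqrt (limit_var l))) * of_real (exp (- limit_var l * (t / sqrt (limit_var l))\<^sup>2 / 2))"
    proof (intro tendsto_mult block_dev_char_limit[OF assms])
      have "isCont cis y" for y
        using continuous_on_cis[of UNIV "\<lambda>x. x"] continuous_on_eq_continuous_at[of UNIV cis] by auto
      then show "(\<lambda>n. cis (- (t * m n / sqrt (v n)))) \<longlonglongrightarrow> cis (- (t * 0 / sqrt (limit_var l)))"
        by (rule isCont_tendsto_compose) (intro tendsto_intros m v, use pos in simp)
      show "(\<lambda>n. t / sqrt (v n)) \<longlonglongrightarrow> t / sqrt (limit_var l)"
        by (intro tendsto_intros v) (use pos in simp)
    qed
    moreover have "cis (- (t * 0 / sqrt (limit_var l))) * of_real (exp (- limit_var l * (t / sqrt (limit_var l))\<^sup>2 / 2)) =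
      char std_normal_distribution t"
      using limit_var_pos[OF assms] by (simp add: char_std_normal_distribution power_divide)
    ultimately show "(\<lambda>n. char (?M n) t) \<longlonglongrightarrow> char std_normal_distribution t" by simp
  qed
  moreover have "isCont (cdf std_normal_distribution) x"
  proof -
    interpret real_distribution std_normal_distribution by (rule real_dist_normal_dist)
    \<comment> \<open>the normal distribution has no atoms\<close>
    have "emeasure std_normal_distribution {x} = 0"
      by (subst emeasure_density) (auto intro!: nn_integral_null_set simp: nn_integral_cmult_indicator mult.commute)
    then show ?thesis by (simp add: isCont_cdf measure_def)
  qed
  ultimately show ?thesis by (simp add: weak_conv_m_def weak_conv_def)
qed

end
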